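(* Assume $\diamondsuit$. Let $B$ be a metric space with no Cantor subsets such that $|B| \le \aleph_1$. Then there is a special Aronszajn tree $T$ for which there is no map $\psi : T \to B$ that is continuous (with respect to the tree topology on $T$) and such that $\psi^{-1}\{b\}$ is discrete in the tree topology for each $b \in B$.
   Context: $\diamondsuit$ is Jensen's diamond principle on $\omega_1$: there is a sequence $\langle A_\alpha : \alpha < \omega_1\rangle$ with $A_\alpha \subseteq \alpha$ such that for every $A \subseteq \omega_1$ the set $\{\alpha < \omega_1 : A \cap \alpha = A_\alpha\}$ is stationary in $\omega_1$. A tree is a set $T$ with a strict partial order $\sqsubset$ such that for each $x \in T$ the set $x{\downarrow} = \{y \in T : y \sqsubset x\}$ is well-ordered by $\sqsubset$. Also $x{\uparrow} = \{y \in T : x \sqsubset y\}$. The height $\mathrm{height}(x)$ is the order type of $x{\downarrow}$, and $\mathcal{L}_\alpha(T) = \{x \in T : \mathrm{height}(x) = \alpha\}$. $T$ is an $\omega_1$-tree iff $|T| = \aleph_1$, each $\mathcal{L}_\alpha(T)$ is countable, and $\mathcal{L}_{\omega_1}(T) = \emptyset$. An Aronszajn tree is an $\omega_1$-tree with no uncountable chains; it is special iff it is a countable union of antichains (an antichain being a set of pairwise $\sqsubset$-incomparable elements). Tree topology on $T$: $U \subseteq T$ is open iff for all $y \in U$ with $\mathrm{height}(y)$ a (nonzero) limit ordinal, there is an $x \sqsubset y$ such that $x{\uparrow} \cap y{\downarrow} \subseteq U$. A subset of $T$ is discrete in the tree topology iff its subspace topology is discrete. A Cantor subset of a space is a subset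 homeomorphic to $2^\omega$. *)

theory Defs
  imports "HOL-Analysis.Analysis"
begin

unbundle cardinal_syntax

section \<open>The ordinal \<open>\<omega>\<^sub>1\<close> and the diamond principle\<close>

text \<open>
  \<open>omega1\<close> is a concrete well-order of type \<open>\<omega>\<^sub>1\<close>: the countable ordinals are the elements of
  \<^term>\<open>Field omega1\<close>, the non-strict order of ordinals is \<open>omega1\<close> itself, and an ordinal \<open>\<alpha>\<close>
  viewed as the set of its predecessors is \<^term>\<open>underS omega1 \<alpha>\<close>.
\<close>

definition omega1 :: "nat set rel" where
  "omega1 = cardSuc natLeq"

lemma countable_iff_le_natLeq: "countable A \<longleftrightarrow> |A| \<le>o natLeq"
proof -
  have "countable A \<longleftrightarrow> |A| \<le>o |UNIV :: nat set|"
    unfolding countable_def using card_of_ordLeq[of A "UNIV :: nat set"] by auto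
  also have "\<dots> \<longleftrightarrow> |A| \<le>o natLeq"
    using card_of_nat ordLeq_ordIso_trans ordIso_symmetric by blast
  finally show ?thesis .
qed

lemma Card_order_omega1: "Card_order omega1"
  unfolding omega1_def by (rule cardSuc_Card_order[OF natLeq_Card_order])

lemma uncountable_Field_omega1: "uncountable (Field omega1)"
proof
  assume "countable (Field omega1)"
  then have "|Field omega1| \<le>o natLeq"
    by (simp add: countable_iff_le_natLeq)
  moreover have "|Field omega1| =o omega1"
    by (rule card_of_Field_ordIso[OF Card_order_omega1])
  ultimately have "omega1 \<le>o natLeq"
    using ordIso_ordLeq_trans ordIso_symmetric by blast
  then show False
    unfolding omega1_def
    using cardSuc_greater[OF natLeq_Card_order] not_ordLess_ordLeq by blast
qed

lemma countable_underS_omega1: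
  assumes "\<alpha> \<in> Field omega1"
  shows "countable (underS omega1 \<alpha>)"
proof -
  have "|underS omega1 \<alpha>| <o omega1"
    by (rule card_of_underS[OF Card_order_omega1 assms])
  then have "|underS omega1 \<alpha>| \<le>o natLeq"
    unfolding omega1_def
    using cardSuc_ordLeq_ordLess[OF natLeq_Card_order card_of_Card_order] by blast
  then show ?thesis
    by (simp add: countable_iff_le_natLeq)
qed

text \<open>
  In the closure clause, the inner condition says that \<open>C \<inter> \<alpha>\<close> is cofinal in \<open>\<alpha>\<close>; since the
  inequality \<open>\<beta> < \<gamma>\<close> is strict, it forces a nonzero \<open>\<alpha>\<close> to be a limit.
\<close>

definition club_omega1 :: "nat set set \<Rightarrow> bool" where
  "club_omega1 C \<longleftrightarrow>
     C \<subseteq> Field omega1 \<and>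
     (\<forall>\<beta>\<in>Field omega1. \<exists>\<gamma>\<in>C. \<beta> \<in> underS omega1 \<gamma>) \<and>
     (\<forall>\<alpha>\<in>Field omega1. underS omega1 \<alpha> \<noteq> {} \<longrightarrow>
        (\<forall>\<beta>\<in>underS omega1 \<alpha>. \<exists>\<gamma>\<in>C \<inter> underS omega1 \<alpha>. \<beta> \<in> underS omega1 \<gamma>) \<longrightarrow> \<alpha> \<in> C)"

definition stationary_omega1 :: "nat set set \<Rightarrow> bool" where
  "stationary_omega1 S \<longleftrightarrow>
     S \<subseteq> Field omega1 \<and> (\<forall>C. club_omega1 C \<longrightarrow> S \<inter> C \<noteq> {})"

definition diamond :: bool where
  "diamond \<longleftrightarrow>
     (\<exists>A :: nat set \<Rightarrow> nat set set.
        (\<forall>\<alpha>\<in>Field omega1. A \<alpha> \<subseteq> underS omega1 \<alpha>) \<and>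
        (\<forall>X. X \<subseteq> Field omega1 \<longrightarrow>
           stationary_omega1 {\<alpha>\<in>Field omega1. X \<inter> underS omega1 \<alpha> = A \<alpha>}))"

section \<open>Trees\<close>

text \<open>A tree is a carrier \<open>T\<close> together with a strict order \<open>R\<close>, where \<open>(x, y) \<in> R\<close> means \<open>x \<sqsubset> y\<close>.\<close>

definition tree_down :: "'a set \<Rightarrow> 'a rel \<Rightarrow> 'a \<Rightarrow> 'a set" where
  "tree_down T R x = {y\<in>T. (y, x) \<in> R}"

definition tree_up :: "'a set \<Rightarrow> 'a rel \<Rightarrow> 'a \<Rightarrow> 'a set" where
  "tree_up T R x = {y\<in>T. (x, y) \<in> R}"

text \<open>
  The height of \<open>x\<close> is represented by the set of predecessors of \<open>x\<close> with its (reflexive) order;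
  heights are to be compared up to the order isomorphism \<open>=o\<close>.
\<close>

definition tree_height :: "'a set \<Rightarrow> 'a rel \<Rightarrow> 'a \<Rightarrow> 'a rel" where
  "tree_height T R x =
     {(y, z). y \<in> tree_down T R x \<and> z \<in> tree_down T R x \<and> (y = z \<or> (y, z) \<in> R)}"

definition is_tree :: "'a set \<Rightarrow> 'a rel \<Rightarrow> bool" where
  "is_tree T R \<longleftrightarrow>
     R \<subseteq> T \<times> T \<and> irrefl R \<and> trans R \<and>
     (\<forall>x\<in>T. well_order_on (tree_down T R x) (tree_height T R x))"

definition tree_level :: "'a set \<Rightarrow> 'a rel \<Rightarrow> 'b rel \<Rightarrow> 'a set" where
  "tree_level T R \<alpha> = {x\<in>T. tree_height T R x =o \<alpha>}"

text \<open>
  Every height of an element of \<open>T\<close> is a well-order on a subset of \<open>'a\<close>, so letting \<open>\<alpha>\<close> range over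
  all well-orders on subsets of \<open>'a\<close> covers all nonempty levels.
\<close>

definition omega1_tree :: "'a set \<Rightarrow> 'a rel \<Rightarrow> bool" where
  "omega1_tree T R \<longleftrightarrow>
     is_tree T R \<and> |T| =o omega1 \<and>
     (\<forall>\<alpha> :: 'a rel. Well_order \<alpha> \<longrightarrow> countable (tree_level T R \<alpha>)) \<and>
     tree_level T R omega1 = {}"

definition tree_chain :: "'a set \<Rightarrow> 'a rel \<Rightarrow> 'a set \<Rightarrow> bool" where
  "tree_chain T R C \<longleftrightarrow> C \<subseteq> T \<and> pairwise (\<lambda>x y. (x, y) \<in> R \<or> (y, x) \<in> R) C"

definition tree_antichain :: "'a set \<Rightarrow> 'a rel \<Rightarrow> 'a set \<Rightarrow> bool" where
  "tree_antichain T R A \<longleftrightarrow> A \<subseteq> T \<and> pairwise (\<lambda>x y. (x, y) \<notin> R \<and> (y, x) \<notin> R) A"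

definition aronszajn_tree :: "'a set \<Rightarrow> 'a rel \<Rightarrow> bool" where
  "aronszajn_tree T R \<longleftrightarrow> omega1_tree T R \<and> (\<forall>C. tree_chain T R C \<longrightarrow> countable C)"

definition special_aronszajn_tree :: "'a set \<Rightarrow> 'a rel \<Rightarrow> bool" where
  "special_aronszajn_tree T R \<longleftrightarrow>
     aronszajn_tree T R \<and>
     (\<exists>A :: nat \<Rightarrow> 'a set. (\<forall>n. tree_antichain T R (A n)) \<and> T = (\<Union>n. A n))"

section \<open>The tree topology\<close>

definition nonzero_limit :: "'a rel \<Rightarrow> bool" where
  "nonzero_limit \<alpha> \<longleftrightarrow> Field \<alpha> \<noteq> {} \<and> (\<forall>i\<in>Field \<alpha>. \<exists>j\<in>Field \<alpha>. j \<noteq> i \<and> (i, j) \<in> \<alpha>)"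

definition tree_open :: "'a set \<Rightarrow> 'a rel \<Rightarrow> 'a set \<Rightarrow> bool" where
  "tree_open T R U \<longleftrightarrow>
     U \<subseteq> T \<and>
     (\<forall>y\<in>U. nonzero_limit (tree_height T R y) \<longrightarrow>
        (\<exists>x\<in>tree_down T R y. tree_up T R x \<inter> tree_down T R y \<subseteq> U))"

definition tree_topology :: "'a set \<Rightarrow> 'a rel \<Rightarrow> 'a topology" where
  "tree_topology T R = topology (tree_open T R)"

lemma Field_tree_height: "Field (tree_height T R x) = tree_down T R x"
  by (auto simp: Field_def tree_height_def)

lemma istopology_tree_open:
  assumes "is_tree T R"
  shows "istopology (tree_open T R)"
  unfolding istopology_def
proof (intro conjI allI impI)
  fix U V
  assume U: "tree_open T R U" and V: "tree_open T R V"
  show "tree_open T R (U \<inter> V)"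
    unfolding tree_open_def
  proof (intro conjI ballI impI)
    show "U \<inter> V \<subseteq> T"
      using U by (auto simp: tree_open_def)
  next
    fix y
    assume y: "y \<in> U \<inter> V" and lim: "nonzero_limit (tree_height T R y)"
    have tr: "trans R"
      using assms by (simp add: is_tree_def)
    have "y \<in> T"
      using y U by (auto simp: tree_open_def)
    then have "total_on (tree_down T R y) (tree_height T R y)"
      using assms by (simp add: is_tree_def well_order_on_def linear_order_on_def)
    then have cmp: "a = b \<or> (a, b) \<in> R \<or> (b, a) \<in> R"
      if "a \<in> tree_down T R y" "b \<in> tree_down T R y" for a b
      using that unfolding total_on_def tree_height_def by blast
    obtain a where a: "a \<in> tree_down T R y" "tree_up T R a \<inter> tree_down T R y \<subseteq> U"
      using U y lim unfolding tree_open_def by blast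
    obtain b where b: "b \<in> tree_down T R y" "tree_up T R b \<inter> tree_down T R y \<subseteq> V"
      using V y lim unfolding tree_open_def by blast
    have mono: "tree_up T R q \<subseteq> tree_up T R p" if "(p, q) \<in> R" for p q
      using that transD[OF tr] unfolding tree_up_def by blast
    show "\<exists>x\<in>tree_down T R y. tree_up T R x \<inter> tree_down T R y \<subseteq> U \<inter> V"
      using cmp[OF a(1) b(1)] a b mono[of a b] mono[of b a] by blast
  qed
next
  fix \<K>
  assume "\<forall>K\<in>\<K>. tree_open T R K"
  then show "tree_open T R (\<Union>\<K>)"
    unfolding tree_open_def by (meson Sup_least UnionE Union_upper subset_trans)
qed

lemma openin_tree_topology:
  assumes "is_tree T R"
  shows "openin (tree_topology T R) U \<longleftrightarrow> tree_open T R U"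
  unfolding tree_topology_def by (simp add: istopology_tree_open[OF assms] topology_inverse')

lemma topspace_tree_topology:
  assumes "is_tree T R"
  shows "topspace (tree_topology T R) = T"
proof -
  have "tree_open T R T"
    unfolding tree_open_def nonzero_limit_def Field_tree_height
    by (auto simp: tree_up_def tree_down_def)
  moreover have "U \<subseteq> T" if "tree_open T R U" for U
    using that by (simp add: tree_open_def)
  ultimately show ?thesis
    unfolding topspace_def openin_tree_topology[OF assms] by blast
qed

section \<open>Discrete subsets and Cantor subsets\<close>

definition discrete_subset :: "'a topology \<Rightarrow> 'a set \<Rightarrow> bool" where
  "discrete_subset X S \<longleftrightarrow> S \<subseteq> topspace X \<and> subtopology X S = discrete_topology S"

definition cantor_space :: "(nat \<Rightarrow> bool) topology" where
  "cantor_space = product_topology (\<lambda>_. discrete_topology UNIV) UNIV"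

definition cantor_subset :: "'a topology \<Rightarrow> 'a set \<Rightarrow> bool" where
  "cantor_subset X C \<longleftrightarrow> C \<subseteq> topspace X \<and> subtopology X C homeomorphic_space cantor_space"

end

theory Submission
  imports Defs
begin

text \<open>
  The nodes of the tree are the triples \<open>(\<alpha>, q, n)\<close> of a countable ordinal (the level), a rational
  number and a natural number. The tree is built by recursion on the level: a node of level \<open>\<alpha>\<close> is
  put on top of a branch through all levels below \<open>\<alpha>\<close> on which the rational coordinates stay below
  its own one. The rational coordinate therefore increases strictly along the tree order, and the tree
  is a special Aronszajn tree whichever branches are chosen. This leaves the branches free to be
  chosen against continuous maps.

  Diamond provides a guess \<open>g \<alpha>\<close>, for each \<open>\<alpha>\<close>, of the restriction to the levels below \<open>\<alpha>\<close> of a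
  map into \<open>B\<close>. A node of level \<open>\<alpha>\<close> takes, if it can, a branch along which \<open>g \<alpha>\<close> has no limit in
  \<open>B\<close>. If all branches available to it have limits, it takes a generic branch if there is one, that
  is, a branch that contains nodes above which \<open>g \<alpha>\<close> oscillates arbitrarily little
  (\<open>tree_with_preferences\<close>).

  Let \<open>\<psi>\<close> be continuous with discrete fibres, and let \<open>\<alpha>\<close> be a limit at which the guess of \<open>\<psi>\<close> is
  correct. By continuity \<open>\<psi>\<close> converges along the branch below each node of level \<open>\<alpha>\<close>, so no node
  of level \<open>\<alpha>\<close> had a divergent branch available: \<open>\<psi>\<close> converges along every branch through the levels
  below \<open>\<alpha>\<close> that is bounded in the rational coordinate. Such \<open>\<alpha>\<close> can moreover be found closed under
  any prescribed operations with countably many values. Call \<open>(x, q)\<close> a condition if \<open>x\<close> is a node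
  with rational coordinate below \<open>q\<close>; it stands for the nodes \<open>v\<close> above \<open>x\<close> with coordinate below
  \<open>q\<close>, and its image is the set of the values \<open>\<psi> v\<close>.

  \<^item> Every condition can be shrunk so that its image has small diameter, since otherwise a bounded
  branch along which \<open>\<psi>\<close> oscillates could be built (\<open>small_oscillation_dense\<close>).

  \<^item> If a condition has no two subconditions whose images are a positive distance apart, then some
  point \<open>c\<close> of \<open>B\<close> is approximated by the values of \<open>\<psi>\<close> inside each of its subconditions
  (\<open>splitting\<close>).

  \<^item> Such a point \<open>c\<close> cannot exist: a node above \<open>x\<close> at a suitable level sits on a generic branch,
  which forces \<open>\<psi>\<close> to take exactly the value \<open>c\<close> there. These levels are unbounded, and a node
  at a limit of them is an accumulation point of its own fibre (\<open>no_essential_value\<close>).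

  \<^item> Hence every condition splits, and iterating the splitting gives a binary tree of conditions
  whose branches converge under \<open>\<psi>\<close> to the points of a Cantor subset of \<open>B\<close>
  (\<open>cantor_subset_exists\<close>).
\<close>


section \<open>The countable ordinals as a well-ordered type\<close>

lemma Well_order_omega1: "Well_order omega1"
  using Card_order_omega1 by (simp add: card_order_on_def)

text \<open>
  Working with a type of order type \<open>\<omega>\<^sub>1\<close> makes the order-theoretic library available and removes
  the carrier \<^term>\<open>Field omega1\<close> from all statements up to the last section.
\<close>

typedef w1 = "Field omega1"
  using uncountable_Field_omega1 by (metis countable_empty ex_in_conv)

instantiation w1 :: wellorder
begin

definition less_eq_w1 :: "w1 \<Rightarrow> w1 \<Rightarrow> bool" where
  "a \<le> b \<longleftrightarrow> (Rep_w1 a, Rep_w1 b) \<in> omega1"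

definition less_w1 :: "w1 \<Rightarrow> w1 \<Rightarrow> bool" where
  "a < b \<longleftrightarrow> Rep_w1 a \<in> underS omega1 (Rep_w1 b)"

instance
proof
  interpret wo_rel omega1
    using Well_order_omega1 by (simp add: wo_rel_def)
  fix a b c :: w1
  show "a < b \<longleftrightarrow> a \<le> b \<and> \<not> b \<le> a"
    unfolding less_w1_def less_eq_w1_def underS_def
    using ANTISYM REFL Rep_w1[of a] Rep_w1_inject[of a b] by (auto simp: antisym_def refl_on_def)
  show "a \<le> a"
    unfolding less_eq_w1_def using REFL Rep_w1[of a] by (auto simp: refl_on_def)
  show "a \<le> c" if "a \<le> b" "b \<le> c"
    using that TRANS unfolding less_eq_w1_def trans_def by blast
  show "a = b" if "a \<le> b" "b \<le> a"
    using that ANTISYM unfolding less_eq_w1_def antisym_def by (metis Rep_w1_inject)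
  show "a \<le> b \<or> b \<le> a"
    using TOTALS Rep_w1[of a] Rep_w1[of b] unfolding less_eq_w1_def by blast
  fix P :: "w1 \<Rightarrow> bool"
  assume step: "\<And>x. (\<And>y. y < x \<Longrightarrow> P y) \<Longrightarrow> P x"
  have "wf (inv_image (omega1 - Id) Rep_w1)"
    by (rule wf_inv_image[OF WF])
  then show "P a"
  proof (induction a rule: wf_induct_rule)
    case (less x)
    show ?case
    proof (rule step)
      fix y assume "y < x"
      then show "P y"
        by (intro less) (auto simp: less_w1_def underS_def)
    qed
  qed
qed

end

lemma Rep_w1_image_lessThan: "Rep_w1 ` {..<a} = underS omega1 (Rep_w1 a)"
proof -
  have "y \<in> Rep_w1 ` {..<a}" if "y \<in> underS omega1 (Rep_w1 a)" for y
  proof -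
    have "y \<in> Field omega1"
      using that by (auto simp: underS_def Field_def)
    then obtain b where "y = Rep_w1 b"
      using Rep_w1_cases by blast
    with that show ?thesis by (auto simp: less_w1_def)
  qed
  then show ?thesis by (auto simp: less_w1_def)
qed

lemma countable_lessThan_w1: "countable {..<a::w1}"
proof -
  have "countable (Rep_w1 ` {..<a})"
    by (simp add: Rep_w1_image_lessThan countable_underS_omega1 Rep_w1)
  then show ?thesis
    by (rule countable_image_inj_on) (simp add: inj_on_def Rep_w1_inject)
qed

lemma uncountable_w1: "uncountable (UNIV :: w1 set)"
proof
  assume "countable (UNIV :: w1 set)"
  then have "countable (Rep_w1 ` UNIV)" by simp
  moreover have "Rep_w1 ` UNIV = Field omega1"
    using type_definition.Rep_range[OF type_definition_w1] .
  ultimately show False using uncountable_Field_omega1 by simp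
qed

text \<open>
  This is the regularity of \<open>\<omega>\<^sub>1\<close>: the initial segments below the members of a countable set are
  countable, so their union is not everything.
\<close>

lemma countable_bounded_w1:
  fixes S :: "w1 set"
  assumes "countable S"
  obtains u where "\<And>s. s \<in> S \<Longrightarrow> s < u"
proof -
  have "countable (\<Union>s\<in>S. insert s {..<s})"
    using assms by (intro countable_UN) (auto simp: countable_lessThan_w1)
  then have "(\<Union>s\<in>S. insert s {..<s}) \<noteq> UNIV"
    using uncountable_w1 by auto
  then obtain u where "u \<notin> (\<Union>s\<in>S. insert s {..<s})" by blast
  then show ?thesis using that[of u] by force
qed

definition limit :: "w1 \<Rightarrow> bool" where
  "limit \<alpha> \<longleftrightarrow> (\<exists>\<beta>. \<beta> < \<alpha>) \<and> (\<forall>\<beta><\<alpha>. \<exists>\<gamma><\<alpha>. \<beta> < \<gamma>)"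

text \<open>
  Unboundedness is the usual closing-off argument: a bound for all values of \<open>F\<close> up to \<open>\<gamma>\<close> exists
  because these are countably many, and the supremum of \<open>\<omega>\<close> iterated bounds is closed under \<open>F\<close>.
\<close>

lemma club_closed_points:
  fixes F :: "w1 \<Rightarrow> w1 set"
  assumes F: "\<And>\<beta>. countable (F \<beta>)"
  shows "club_omega1 (Rep_w1 ` {\<alpha>. limit \<alpha> \<and> (\<forall>\<beta><\<alpha>. F \<beta> \<subseteq> {..<\<alpha>})})" (is "club_omega1 (Rep_w1 ` ?C)")
  unfolding club_omega1_def
proof (intro conjI ballI impI)
  show "Rep_w1 ` ?C \<subseteq> Field omega1"
    using Rep_w1 by auto
next
  fix b assume "b \<in> Field omega1"
  then obtain \<beta> where b: "b = Rep_w1 \<beta>"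
    using Rep_w1_cases by blast
  have "\<exists>u. \<gamma> < u \<and> (\<forall>\<delta>\<le>\<gamma>. F \<delta> \<subseteq> {..<u})" for \<gamma>
  proof -
    have "countable (insert \<gamma> (\<Union>\<delta>\<in>insert \<gamma> {..<\<gamma>}. F \<delta>))"
      using F by (intro countable_insert countable_UN) (auto simp: countable_lessThan_w1)
    then obtain u where "\<And>s. s \<in> insert \<gamma> (\<Union>\<delta>\<in>insert \<gamma> {..<\<gamma>}. F \<delta>) \<Longrightarrow> s < u"
      using countable_bounded_w1 by blast
    then show ?thesis by (intro exI[of _ u]) (auto simp: le_less)
  qed
  then obtain nx where nx: "\<And>\<gamma>. \<gamma> < nx \<gamma>" "\<And>\<gamma> \<delta>. \<delta> \<le> \<gamma> \<Longrightarrow> F \<delta> \<subseteq> {..<nx \<gamma>}"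
    by metis
  define s where "s n = (nx ^^ n) \<beta>" for n
  have sSuc: "s (Suc n) = nx (s n)" for n by (simp add: s_def)
  obtain u where "\<And>x. x \<in> range s \<Longrightarrow> x < u"
    using countable_bounded_w1[of "range s"] by auto
  then have ex: "\<exists>u. \<forall>n. s n < u" by blast
  define \<alpha> where "\<alpha> = (LEAST u. \<forall>n. s n < u)"
  have lt: "s n < \<alpha>" for n
    using LeastI_ex[OF ex] by (simp add: \<alpha>_def)
  have least: "\<exists>n. \<gamma> \<le> s n" if "\<gamma> < \<alpha>" for \<gamma>
    using not_less_Least[of \<gamma> "\<lambda>u. \<forall>n. s n < u"] that by (auto simp: \<alpha>_def not_less)
  have "\<alpha> \<in> ?C"
  proof (intro CollectI conjI allI impI)
    show "limit \<alpha>"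
      unfolding limit_def
    proof (intro conjI allI impI)
      show "\<exists>\<gamma>. \<gamma> < \<alpha>" using lt by blast
    next
      fix \<gamma> assume "\<gamma> < \<alpha>"
      then obtain n where "\<gamma> \<le> s n" using least by blast
      then have "\<gamma> < s (Suc n)" using nx(1)[of "s n"] by (simp add: sSuc)
      then show "\<exists>\<delta><\<alpha>. \<gamma> < \<delta>" using lt by blast
    qed
  next
    fix \<gamma> assume "\<gamma> < \<alpha>"
    then obtain n where "\<gamma> \<le> s n" using least by blast
    then have "F \<gamma> \<subseteq> {..<s (Suc n)}" using nx(2) by (simp add: sSuc)
    then show "F \<gamma> \<subseteq> {..<\<alpha>}" using lt[of "Suc n"] by (auto intro: less_trans)
  qed
  moreover have "b \<in> underS omega1 (Rep_w1 \<alpha>)"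
    using lt[of 0] by (simp add: b s_def less_w1_def)
  ultimately show "\<exists>\<gamma>\<in>Rep_w1 ` ?C. b \<in> underS omega1 \<gamma>" by blast
next
  fix a
  assume "a \<in> Field omega1" and ne: "underS omega1 a \<noteq> {}"
    and cof: "\<forall>b\<in>underS omega1 a. \<exists>c\<in>Rep_w1 ` ?C \<inter> underS omega1 a. b \<in> underS omega1 c"
  then obtain \<alpha> where a: "a = Rep_w1 \<alpha>"
    using Rep_w1_cases by blast
  have cof': "\<exists>\<gamma>\<in>?C. \<gamma> < \<alpha> \<and> \<beta> < \<gamma>" if "\<beta> < \<alpha>" for \<beta>
    using cof that unfolding a less_w1_def by blast
  have "\<alpha> \<in> ?C"
  proof (intro CollectI conjI allI impI)
    show "limit \<alpha>"
    proof -
      have "\<exists>\<beta>. \<beta> < \<alpha>"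
        using ne by (auto simp: a Rep_w1_image_lessThan[symmetric])
      then show ?thesis
        unfolding limit_def using cof' by blast
    qed
  next
    fix \<beta> assume "\<beta> < \<alpha>"
    then obtain \<gamma> where "\<gamma> \<in> ?C" "\<gamma> < \<alpha>" "\<beta> < \<gamma>" using cof' by blast
    then show "F \<beta> \<subseteq> {..<\<alpha>}" by fastforce
  qed
  then show "a \<in> Rep_w1 ` ?C" by (simp add: a)
qed

section \<open>Guessing functions by diamond\<close>

text \<open>
  The stationary set in diamond is only ever intersected with the club of closure points of a
  countable-valued operation \<open>F\<close>, so this intersection is built into the statement.
\<close>

lemma diamond_w1:
  assumes diamond
  obtains A :: "w1 \<Rightarrow> w1 set" where
    "\<And>X F. (\<And>\<beta>. countable (F \<beta>)) \<Longrightarrow>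
       \<exists>\<alpha>. limit \<alpha> \<and> (\<forall>\<beta><\<alpha>. F \<beta> \<subseteq> {..<\<alpha>}) \<and> A \<alpha> = X \<inter> {..<\<alpha>}"
proof -
  from assms obtain A0 where A0:
    "\<And>X. X \<subseteq> Field omega1 \<Longrightarrow>
       stationary_omega1 {\<alpha>\<in>Field omega1. X \<inter> underS omega1 \<alpha> = A0 \<alpha>}"
    unfolding diamond_def by blast
  show ?thesis
  proof (rule that[of "\<lambda>\<alpha>. Rep_w1 -` A0 (Rep_w1 \<alpha>)"])
    fix X and F :: "w1 \<Rightarrow> w1 set"
    assume F: "\<And>\<beta>. countable (F \<beta>)"
    have "Rep_w1 ` X \<subseteq> Field omega1" using Rep_w1 by auto
    then have "{\<alpha>\<in>Field omega1. Rep_w1 ` X \<inter> underS omega1 \<alpha> = A0 \<alpha>} \<inter>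
        Rep_w1 ` {\<alpha>. limit \<alpha> \<and> (\<forall>\<beta><\<alpha>. F \<beta> \<subseteq> {..<\<alpha>})} \<noteq> {}"
      using A0 club_closed_points[of F, OF F] unfolding stationary_omega1_def by blast
    then obtain \<alpha> where \<alpha>: "limit \<alpha>" "\<forall>\<beta><\<alpha>. F \<beta> \<subseteq> {..<\<alpha>}"
      and eq: "Rep_w1 ` X \<inter> underS omega1 (Rep_w1 \<alpha>) = A0 (Rep_w1 \<alpha>)" by blast
    have "Rep_w1 -` A0 (Rep_w1 \<alpha>) = X \<inter> {..<\<alpha>}"
      unfolding eq[symmetric] Rep_w1_image_lessThan[symmetric] by (auto simp: Rep_w1_inject)
    with \<alpha> show "\<exists>\<alpha>. limit \<alpha> \<and> (\<forall>\<beta><\<alpha>. F \<beta> \<subseteq> {..<\<alpha>}) \<and> Rep_w1 -` A0 (Rep_w1 \<alpha>) = X \<inter> {..<\<alpha>}"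
      by blast
  qed
qed

text \<open>
  A datatype is used in place of a product type because nodes should be opaque to simplification.
  The rational coordinate \<open>rho\<close> will witness that the tree is special.
\<close>

datatype node = Node (lev: w1) (rho: rat) (index: nat)

lemma countable_level: "countable {x. lev x = \<alpha>}"
proof -
  have "{x. lev x = \<alpha>} = range (\<lambda>(q, n). Node \<alpha> q n)"
    by (auto simp: image_iff) (metis node.collapse)
  then show ?thesis by simp
qed

lemma countable_lev_less: "countable {x. lev x < \<alpha>}"
proof -
  have "{x. lev x < \<alpha>} = (\<Union>\<beta>\<in>{..<\<alpha>}. {x. lev x = \<beta>})" by auto
  also have "countable \<dots>"
    by (intro countable_UN countable_lessThan_w1 countable_level)
  finally show ?thesis .
qed

lemma card_of_w1: "|UNIV :: w1 set| =o omega1"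
proof -
  have "bij_betw Rep_w1 UNIV (Field omega1)"
    using type_definition.Rep_range[OF type_definition_w1]
    by (auto simp: bij_betw_def inj_on_def Rep_w1_inject)
  then have "|UNIV :: w1 set| =o |Field omega1|"
    using card_of_ordIso by blast
  then show ?thesis
    using card_of_Field_ordIso[OF Card_order_omega1] ordIso_transitive by blast
qed

lemma infinite_w1: "infinite (UNIV :: w1 set)"
  using uncountable_w1 countable_finite by blast

lemma card_of_node: "|UNIV :: node set| =o omega1"
proof -
  have "|UNIV :: (rat \<times> nat) set| \<le>o natLeq"
    using countable_iff_le_natLeq by blast
  also have "natLeq \<le>o |UNIV :: w1 set|"
    using infinite_w1 infinite_iff_natLeq_ordLeq by blast
  finally have "|(UNIV :: w1 set) \<times> (UNIV :: (rat \<times> nat) set)| =o |UNIV :: w1 set|"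
    using infinite_w1 by (intro card_of_Times_infinite_simps) auto
  then have "|UNIV :: (w1 \<times> rat \<times> nat) set| =o omega1"
    using card_of_w1 ordIso_transitive by (metis UNIV_Times_UNIV)
  moreover have "bij (\<lambda>x. (lev x, rho x, index x))"
    by (rule o_bij[of "\<lambda>(\<alpha>, q, n). Node \<alpha> q n"]) auto
  ultimately show ?thesis
    using card_of_ordIso ordIso_transitive by blast
qed

text \<open>
  A function from nodes to \<open>B\<close> is coded by the set of codes of the points of its graph. Where the
  guess of this set is correct and the ordinal is closed under coding, the guessed set
  determines the function on all lower levels.
\<close>

lemma diamond_guesses_functions:
  assumes diamond and B: "|B| \<le>o omega1"
  obtains g :: "w1 \<Rightarrow> node \<Rightarrow> 'b" where
    "\<And>\<psi> F. (\<And>x. \<psi> x \<in> B) \<Longrightarrow> (\<And>x. countable (F x)) \<Longrightarrow>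
       \<exists>\<alpha>. limit \<alpha> \<and> (\<forall>x. lev x < \<alpha> \<longrightarrow> (\<forall>y\<in>F x. lev y < \<alpha>)) \<and> (\<forall>x. lev x < \<alpha> \<longrightarrow> g \<alpha> x = \<psi> x)"
proof -
  obtain A :: "w1 \<Rightarrow> w1 set" where A:
    "\<And>X F. (\<And>\<beta>. countable (F \<beta>)) \<Longrightarrow>
       \<exists>\<alpha>. limit \<alpha> \<and> (\<forall>\<beta><\<alpha>. F \<beta> \<subseteq> {..<\<alpha>}) \<and> A \<alpha> = X \<inter> {..<\<alpha>}"
    using diamond_w1[OF assms(1)] by blast
  have w1_sym: "omega1 =o |UNIV :: w1 set|"
    using card_of_w1 ordIso_symmetric by blast
  have "|B| \<le>o |UNIV :: w1 set|"
    using B w1_sym ordLeq_ordIso_trans by blast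
  then obtain i :: "'b \<Rightarrow> w1" where i: "inj_on i B"
    using card_of_ordLeq[of B "UNIV :: w1 set"] by auto
  have "|UNIV :: node set| \<le>o |UNIV :: w1 set|"
    using card_of_node w1_sym ordIso_transitive ordIso_imp_ordLeq by blast
  then have "|(UNIV :: w1 set) \<times> (UNIV :: node set)| \<le>o |UNIV :: w1 set|"
    using card_of_Times_infinite_simps(1)[OF infinite_w1, of "UNIV :: node set"]
    by (simp add: ordIso_imp_ordLeq)
  then obtain code :: "w1 \<times> node \<Rightarrow> w1" where code: "inj code"
    using card_of_ordLeq[of "(UNIV :: w1 set) \<times> (UNIV :: node set)" "UNIV :: w1 set"] by auto
  define g where "g \<alpha> x = (SOME b. b \<in> B \<and> code (i b, x) \<in> A \<alpha>)" for \<alpha> x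
  show ?thesis
  proof (rule that[of g])
    fix \<psi> :: "node \<Rightarrow> 'b" and F :: "node \<Rightarrow> node set"
    assume \<psi>: "\<And>x. \<psi> x \<in> B" and F: "\<And>x. countable (F x)"
    define X where "X = range (\<lambda>x. code (i (\<psi> x), x))"
    define F' where "F' \<beta> = (\<Union>x\<in>{x. lev x = \<beta>}. insert (code (i (\<psi> x), x)) (lev ` F x))" for \<beta>
    have "countable (F' \<beta>)" for \<beta>
      unfolding F'_def using F by (intro countable_UN countable_level) auto
    from A[of F' X, OF this] obtain \<alpha> where lim: "limit \<alpha>"
      and cl: "\<And>\<beta>. \<beta> < \<alpha> \<Longrightarrow> F' \<beta> \<subseteq> {..<\<alpha>}" and eq: "A \<alpha> = X \<inter> {..<\<alpha>}"
      by blast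
    have "g \<alpha> x = \<psi> x" if "lev x < \<alpha>" for x
    proof -
      have "code (i (\<psi> x), x) \<in> F' (lev x)"
        unfolding F'_def by blast
      then have "code (i (\<psi> x), x) \<in> A \<alpha>"
        using cl[OF that] unfolding eq X_def by blast
      moreover have "b = \<psi> x" if b: "b \<in> B" "code (i b, x) \<in> A \<alpha>" for b
      proof -
        obtain x' where "code (i b, x) = code (i (\<psi> x'), x')"
          using b(2) unfolding eq X_def by blast
        then have "(i b, x) = (i (\<psi> x'), x')"
          by (rule injD[OF code])
        then show ?thesis
          using inj_onD[OF i] \<psi> b(1) by simp
      qed
      ultimately show ?thesis
        unfolding g_def using \<psi> by (intro some_equality) auto
    qed
    moreover have "lev y < \<alpha>" if "lev x < \<alpha>" "y \<in> F x" for x y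
    proof -
      have "lev y \<in> F' (lev x)"
        using that(2) unfolding F'_def by blast
      then show ?thesis using cl[OF that(1)] by blast
    qed
    ultimately show "\<exists>\<alpha>. limit \<alpha> \<and> (\<forall>x. lev x < \<alpha> \<longrightarrow> (\<forall>y\<in>F x. lev y < \<alpha>)) \<and>
        (\<forall>x. lev x < \<alpha> \<longrightarrow> g \<alpha> x = \<psi> x)"
      using lim by blast
  qed
qed

section \<open>Branches and partial trees\<close>

text \<open>
  A tree is given by the function \<open>f\<close> that sends a node to the set of its predecessors. A branch below
  \<open>\<alpha>\<close> has exactly one node on each level below \<open>\<alpha>\<close>, and the predecessors of its nodes are the
  expected ones. Only values of \<open>f\<close> below level \<open>\<alpha>\<close> matter, which is what allows \<open>f\<close> to be defined
  by recursion on the level.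
\<close>

definition branch :: "(node \<Rightarrow> node set) \<Rightarrow> w1 \<Rightarrow> node set \<Rightarrow> bool" where
  "branch f \<alpha> P \<longleftrightarrow>
     inj_on lev P \<and> lev ` P = {..<\<alpha>} \<and> (\<forall>x\<in>P. f x = {w\<in>P. lev w < lev x})"

definition ext :: "(node \<Rightarrow> node set) \<Rightarrow> node \<Rightarrow> node \<Rightarrow> bool" where
  "ext f x y \<longleftrightarrow> x = y \<or> x \<in> f y"

text \<open>
  The third coordinate of a node enumerates the nodes of lower level. It names the node that the new
  one should lie above, so that every node has successors on all higher levels.
\<close>

definition target :: "node \<Rightarrow> node" where
  "target y = from_nat_into {v. lev v < lev y} (index y)"

definition admissible :: "(node \<Rightarrow> node set) \<Rightarrow> node \<Rightarrow> node set \<Rightarrow> bool" where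
  "admissible f y P \<longleftrightarrow>
     branch f (lev y) P \<and> (\<forall>w\<in>P. rho w < rho y) \<and>
     (lev (target y) < lev y \<and> rho (target y) < rho y \<longrightarrow> target y \<in> P)"

lemma target_surj:
  assumes "lev v < \<alpha>"
  obtains y where "lev y = \<alpha>" "rho y = q" "target y = v"
proof -
  obtain n where "from_nat_into {v. lev v < \<alpha>} n = v"
    using from_nat_into_surj[OF countable_lev_less] assms by blast
  then show ?thesis
    using that[of "Node \<alpha> q n"] by (simp add: target_def)
qed

lemma branch_cong:
  assumes "\<And>x. lev x < \<alpha> \<Longrightarrow> f x = g x"
  shows "branch f \<alpha> P = branch g \<alpha> P"
proof -
  have *: "(\<forall>x\<in>P. f x = {w\<in>P. lev w < lev x}) \<longleftrightarrow> (\<forall>x\<in>P. g x = {w\<in>P. lev w < lev x})"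
    if "lev ` P = {..<\<alpha>}"
  proof (intro ball_cong refl)
    fix x assume "x \<in> P"
    then have "f x = g x" using that assms by blast
    then show "f x = {w\<in>P. lev w < lev x} \<longleftrightarrow> g x = {w\<in>P. lev w < lev x}" by simp
  qed
  show ?thesis
    unfolding branch_def by (intro conj_cong refl *)
qed

lemma admissible_cong:
  assumes "\<And>x. lev x < lev y \<Longrightarrow> f x = g x"
  shows "admissible f y P \<longleftrightarrow> admissible g y P"
  unfolding admissible_def using branch_cong[of "lev y" f g] assms by simp

lemma branch_inj: "branch f \<alpha> P \<Longrightarrow> inj_on lev P"
  by (simp add: branch_def)

lemma branch_levels: "branch f \<alpha> P \<Longrightarrow> lev ` P = {..<\<alpha>}"
  by (simp add: branch_def)

lemma branch_below: "branch f \<alpha> P \<Longrightarrow> x \<in> P \<Longrightarrow> f x = {w\<in>P. lev w < lev x}"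
  by (simp add: branch_def)

lemma branch_lev: "branch f \<alpha> P \<Longrightarrow> x \<in> P \<Longrightarrow> lev x < \<alpha>"
  using branch_levels by blast

lemma branch_level:
  assumes "branch f \<alpha> P" "\<beta> < \<alpha>"
  obtains x where "x \<in> P" "lev x = \<beta>"
proof -
  have "\<beta> \<in> lev ` P" using assms by (simp add: branch_levels)
  then show ?thesis using that by blast
qed

lemma branch_down:
  assumes "branch f \<alpha> P" "y \<in> P" "ext f x y"
  shows "x \<in> P"
  using assms(2,3) branch_below[OF assms(1,2)] by (auto simp: ext_def)

lemma branch_chain:
  assumes P: "branch f \<alpha> P" "x \<in> P" "y \<in> P" and le: "lev x \<le> lev y"
  shows "ext f x y"
proof (cases "lev x = lev y")
  case True
  then show ?thesis using inj_onD[OF branch_inj[OF P(1)] True P(2,3)] by (simp add: ext_def)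
next
  case False
  then show ?thesis using branch_below[OF P(1,3)] P(2) le by (simp add: ext_def less_le)
qed

text \<open>
  The tree has been built on the levels in \<open>D\<close>. During the recursion \<open>D\<close> is an initial segment; for the
  finished tree it is the whole type.
\<close>

locale tree_on =
  fixes f :: "node \<Rightarrow> node set" and D :: "w1 set"
  assumes adm: "\<And>x. lev x \<in> D \<Longrightarrow> admissible f x (f x)"
    and D_down: "\<And>\<alpha> \<beta>. \<alpha> \<in> D \<Longrightarrow> \<beta> < \<alpha> \<Longrightarrow> \<beta> \<in> D"
begin

lemma branch_f: "lev x \<in> D \<Longrightarrow> branch f (lev x) (f x)"
  using adm by (simp add: admissible_def)

lemma lev_f: "lev y \<in> D \<Longrightarrow> x \<in> f y \<Longrightarrow> lev x < lev y"
  using branch_lev[OF branch_f] .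

lemma rho_f: "lev y \<in> D \<Longrightarrow> x \<in> f y \<Longrightarrow> rho x < rho y"
  using adm by (simp add: admissible_def)

lemma f_trans: "lev z \<in> D \<Longrightarrow> y \<in> f z \<Longrightarrow> x \<in> f y \<Longrightarrow> x \<in> f z"
  using branch_down[OF branch_f, of z y x] by (simp add: ext_def)

lemma target_in_f:
  "lev y \<in> D \<Longrightarrow> lev (target y) < lev y \<Longrightarrow> rho (target y) < rho y \<Longrightarrow> target y \<in> f y"
  using adm by (simp add: admissible_def)

lemma ext_lev: "lev y \<in> D \<Longrightarrow> ext f x y \<Longrightarrow> lev x \<le> lev y"
  using lev_f[of y x] by (auto simp: ext_def)

lemma ext_rho: "lev y \<in> D \<Longrightarrow> ext f x y \<Longrightarrow> rho x \<le> rho y"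
  using rho_f[of y x] by (auto simp: ext_def)

lemma ext_trans: "lev z \<in> D \<Longrightarrow> ext f x y \<Longrightarrow> ext f y z \<Longrightarrow> ext f x z"
  using f_trans by (auto simp: ext_def)

lemma ext_comparable:
  assumes z: "lev z \<in> D" and "ext f x z" "ext f y z" "lev x \<le> lev y"
  shows "ext f x y"
proof (cases "y = z")
  case True
  then show ?thesis using assms by simp
next
  case False
  then have y: "y \<in> f z" using assms by (simp add: ext_def)
  then have "x \<in> f z" using assms lev_f[OF z y] by (auto simp: ext_def)
  then show ?thesis using branch_chain[OF branch_f[OF z]] y assms by blast
qed

text \<open>
  Extendibility of nodes: the enumeration of targets provides, for \<open>r\<close> strictly between \<open>rho z\<close> and
  \<open>q\<close>, a node of level \<open>\<beta>\<close> and coordinate \<open>r\<close> above \<open>z\<close>.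
\<close>

lemma climb:
  assumes \<alpha>: "{..<\<alpha>} \<subseteq> D" and z: "lev z < \<alpha>" "rho z < q" and \<beta>: "\<beta> < \<alpha>"
  obtains z' where "ext f z z'" "lev z' < \<alpha>" "rho z' < q" "\<beta> \<le> lev z'"
proof (cases "\<beta> \<le> lev z")
  case True
  then show ?thesis using that[of z] z by (simp add: ext_def)
next
  case False
  obtain r where r: "rho z < r" "r < q" using dense[OF z(2)] by blast
  have "lev z < \<beta>" using False by simp
  then obtain y where y: "lev y = \<beta>" "rho y = r" "target y = z"
    by (rule target_surj)
  then have "z \<in> f y"
    using target_in_f[of y] \<alpha> \<beta> False r by auto
  then show ?thesis using that[of y] y r \<beta> by (simp add: ext_def)
qed

text \<open>
  New branches arise from increasing sequences of nodes with cofinal levels. The levels increase only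
  weakly, so that a sequence may become constant; this treats successor and limit ordinals \<open>\<alpha>\<close> alike.
\<close>

lemma branch_of_chain:
  fixes X :: "nat \<Rightarrow> node"
  assumes \<alpha>: "{..<\<alpha>} \<subseteq> D" and X: "\<And>n. lev (X n) < \<alpha>" "\<And>n. ext f (X n) (X (Suc n))"
    and cof: "\<And>\<beta>. \<beta> < \<alpha> \<Longrightarrow> \<exists>n. \<beta> \<le> lev (X n)"
  shows "branch f \<alpha> {w. \<exists>n. ext f w (X n)}" (is "branch f \<alpha> ?P")
proof -
  have XD: "lev (X n) \<in> D" for n using X(1) \<alpha> by auto
  have mono: "ext f (X m) (X n)" if "m \<le> n" for m n
    using that
  proof (induction n rule: dec_induct)
    case base then show ?case by (simp add: ext_def)
  next
    case (step n) then show ?case using ext_trans[OF XD step.IH X(2)] by simp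
  qed
  have common: "\<exists>n. ext f v (X n) \<and> ext f w (X n)" if "v \<in> ?P" "w \<in> ?P" for v w
  proof -
    from that obtain m n where mn: "ext f v (X m)" "ext f w (X n)" by blast
    have "ext f v (X (max m n))" "ext f w (X (max m n))"
      using ext_trans[OF XD mn(1) mono[of m "max m n"]] ext_trans[OF XD mn(2) mono[of n "max m n"]]
      by simp_all
    then show ?thesis by blast
  qed
  have PD: "lev w < \<alpha>" if "w \<in> ?P" for w
    using that ext_lev[OF XD] X(1) le_less_trans by blast
  show ?thesis
    unfolding branch_def
  proof (intro conjI ballI)
    show "inj_on lev ?P"
    proof (rule inj_onI)
      fix v w assume v: "v \<in> ?P" and w: "w \<in> ?P" and eq: "lev v = lev w"
      then obtain n where "ext f v (X n)" "ext f w (X n)" using common by blast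
      then have "ext f v w" using ext_comparable[OF XD] eq by simp
      moreover have "v \<notin> f w" using lev_f[of w v] PD[OF w] \<alpha> eq by auto
      ultimately show "v = w" by (simp add: ext_def)
    qed
  next
    show "lev ` ?P = {..<\<alpha>}"
    proof
      show "lev ` ?P \<subseteq> {..<\<alpha>}" using PD by blast
    next
      show "{..<\<alpha>} \<subseteq> lev ` ?P"
      proof
        fix \<beta> assume "\<beta> \<in> {..<\<alpha>}"
        then obtain n where n: "\<beta> \<le> lev (X n)" using cof by blast
        show "\<beta> \<in> lev ` ?P"
        proof (cases "\<beta> = lev (X n)")
          case True
          then show ?thesis by (auto simp: ext_def)
        next
          case False
          then have "\<beta> < lev (X n)" using n by simp
          then obtain x where "x \<in> f (X n)" "lev x = \<beta>"
            by (rule branch_level[OF branch_f[OF XD]])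
          then show ?thesis by (auto simp: ext_def)
        qed
      qed
    qed
  next
    fix x assume x: "x \<in> ?P"
    then have xD: "lev x \<in> D" using PD \<alpha> by blast
    show "f x = {w \<in> ?P. lev w < lev x}"
    proof (intro equalityI subsetI)
      fix w assume w: "w \<in> f x"
      obtain n where "ext f x (X n)" using x by blast
      then have "ext f w (X n)" using ext_trans[OF XD, of w x] w by (simp add: ext_def)
      then show "w \<in> {w \<in> ?P. lev w < lev x}" using lev_f[OF xD w] by blast
    next
      fix w assume w: "w \<in> {w \<in> ?P. lev w < lev x}"
      then obtain n where n: "ext f w (X n)" "ext f x (X n)" using common x by blast
      have lt: "lev w < lev x" using w by blast
      then have "w \<noteq> x" by blast
      moreover have "ext f w x" by (rule ext_comparable[OF XD n less_imp_le[OF lt]])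
      ultimately show "w \<in> f x" unfolding ext_def by blast
    qed
  qed
qed

text \<open>
  The Rasiowa-Sikorski argument for the countable poset of nodes above \<open>x\<close> with coordinate below \<open>q\<close>:
  the sequence meets the dense sets \<open>G n\<close> one after the other, and climbs to the \<open>n\<close>-th level of an
  enumeration of the levels below \<open>\<alpha>\<close> in between.
\<close>

lemma generic_branch:
  fixes G :: "nat \<Rightarrow> node set"
  assumes \<alpha>: "{..<\<alpha>} \<subseteq> D" and x: "lev x < \<alpha>" "rho x < q"
    and dense: "\<And>n z. ext f x z \<Longrightarrow> lev z < \<alpha> \<Longrightarrow> rho z < q \<Longrightarrow>
      \<exists>z'\<in>G n. ext f z z' \<and> lev z' < \<alpha> \<and> rho z' < q"
  shows "\<exists>P. branch f \<alpha> P \<and> x \<in> P \<and> (\<forall>w\<in>P. rho w < q) \<and> (\<forall>n. P \<inter> G n \<noteq> {})"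
proof -
  let ?a = "from_nat_into {..<\<alpha>}"
  have a: "?a n < \<alpha>" for n
    using from_nat_into[of "{..<\<alpha>}" n] x(1) by auto
  let ?ok = "\<lambda>z. ext f x z \<and> lev z < \<alpha> \<and> rho z < q"
  have "\<exists>z'. ?ok z' \<and> ext f z z' \<and> ?a n \<le> lev z' \<and> (\<exists>u\<in>G n. ext f u z')" if z: "?ok z" for n z
  proof -
    obtain u where u: "u \<in> G n" "ext f z u" "lev u < \<alpha>" "rho u < q"
      using dense z by blast
    obtain z' where z': "ext f u z'" "lev z' < \<alpha>" "rho z' < q" "?a n \<le> lev z'"
      using climb[OF \<alpha> u(3,4) a[of n]] by blast
    have "ext f z z'" "ext f x z'"
      using ext_trans[of z'] u z' z \<alpha> by blast+
    then show ?thesis using u(1) z' by blast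
  qed
  then have "\<exists>z'. (?ok z' \<and> (Suc n = 0 \<longrightarrow> z' = x)) \<and>
      ext f z z' \<and> ?a n \<le> lev z' \<and> (\<exists>u\<in>G n. ext f u z')"
    if "?ok z \<and> (n = 0 \<longrightarrow> z = x)" for z and n :: nat
    using that by blast
  moreover have "\<exists>z. ?ok z \<and> ((0::nat) = 0 \<longrightarrow> z = x)"
    using x by (auto simp: ext_def)
  ultimately obtain X where X':
    "\<And>n. (?ok (X n) \<and> (n = 0 \<longrightarrow> X n = x)) \<and>
      ext f (X n) (X (Suc n)) \<and> ?a n \<le> lev (X (Suc n)) \<and> (\<exists>u\<in>G n. ext f u (X (Suc n)))"
    using dependent_nat_choice[of "\<lambda>n z. ?ok z \<and> (n = 0 \<longrightarrow> z = x)"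
        "\<lambda>n z z'. ext f z z' \<and> ?a n \<le> lev z' \<and> (\<exists>u\<in>G n. ext f u z')"] by blast
  have X0: "X 0 = x" using X'[of 0] by simp
  have X: "\<And>n. ?ok (X n)"
    "\<And>n. ext f (X n) (X (Suc n)) \<and> ?a n \<le> lev (X (Suc n)) \<and> (\<exists>u\<in>G n. ext f u (X (Suc n)))"
    using X' by simp_all
  let ?P = "{w. \<exists>n. ext f w (X n)}"
  have "branch f \<alpha> ?P"
  proof (rule branch_of_chain[OF \<alpha>])
    fix \<beta> assume "\<beta> < \<alpha>"
    then obtain n where "?a n = \<beta>"
      using from_nat_into_surj[OF countable_lessThan_w1, of \<beta> \<alpha>] by auto
    then show "\<exists>n. \<beta> \<le> lev (X n)" using X(2) by blast
  qed (use X in auto)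
  moreover have "x \<in> ?P" using X0 by (auto simp: ext_def)
  moreover have "rho w < q" if "w \<in> ?P" for w
  proof -
    from that obtain n where "ext f w (X n)" by blast
    then have "rho w \<le> rho (X n)" using ext_rho[of "X n"] X(1)[of n] \<alpha> by auto
    then show ?thesis using X(1)[of n] by simp
  qed
  moreover have "?P \<inter> G n \<noteq> {}" for n
  proof -
    obtain u where "u \<in> G n" "ext f u (X (Suc n))" using X(2)[of n] by blast
    then have "u \<in> ?P \<inter> G n" by blast
    then show ?thesis by blast
  qed
  ultimately have "branch f \<alpha> ?P \<and> x \<in> ?P \<and> (\<forall>w\<in>?P. rho w < q) \<and> (\<forall>n. ?P \<inter> G n \<noteq> {})"
    by simp
  then show ?thesis by (rule exI)
qed

lemma admissible_start:
  assumes "\<beta> < lev y"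
  obtains x where "lev x < lev y" "rho x < rho y"
    "lev (target y) < lev y \<and> rho (target y) < rho y \<longrightarrow> x = target y"
proof (cases "lev (target y) < lev y \<and> rho (target y) < rho y")
  case True
  then show ?thesis using that[of "target y"] by simp
next
  case False
  then show ?thesis using that[of "Node \<beta> (rho y - 1) 0"] assms by auto
qed

lemma admissible_exists:
  assumes "{..<lev y} \<subseteq> D"
  shows "\<exists>P. admissible f y P"
proof (cases "\<exists>\<beta>. \<beta> < lev y")
  case True
  then obtain \<beta> where "\<beta> < lev y" by blast
  then obtain x where x: "lev x < lev y" "rho x < rho y"
    "lev (target y) < lev y \<and> rho (target y) < rho y \<longrightarrow> x = target y"
    by (rule admissible_start)
  define G :: "nat \<Rightarrow> node set" where "G n = UNIV" for n
  have dense: "\<exists>z'\<in>G n. ext f z z' \<and> lev z' < lev y \<and> rho z' < rho y"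
    if "ext f x z" "lev z < lev y" "rho z < rho y" for n z
    using that by (auto simp: ext_def G_def)
  obtain P where P: "branch f (lev y) P" "x \<in> P" "\<And>w. w \<in> P \<Longrightarrow> rho w < rho y"
    "\<And>n. P \<inter> G n \<noteq> {}"
    using generic_branch[where G = G, OF assms x(1,2) dense] by auto
  have "target y \<in> P" if "lev (target y) < lev y \<and> rho (target y) < rho y"
    using P(2) x(3) that by simp
  then have "admissible f y P" unfolding admissible_def using P by simp
  then show ?thesis ..
next
  case False
  then have "admissible f y {}" by (auto simp: admissible_def branch_def)
  then show ?thesis ..
qed

end

text \<open>
  The recursion that builds the tree. The predicate \<open>W\<close> expresses a wish about the branch below a
  node, which is fulfilled whenever an admissible branch fulfils it.
\<close>

lemma tree_with_preferences:
  fixes W :: "(node \<Rightarrow> node set) \<Rightarrow> node \<Rightarrow> node set \<Rightarrow> bool"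
  assumes W: "\<And>f g y P. (\<And>x. lev x < lev y \<Longrightarrow> f x = g x) \<Longrightarrow> W f y P = W g y P"
  obtains f where "\<And>y. admissible f y (f y)"
    "\<And>y P. admissible f y P \<Longrightarrow> W f y P \<Longrightarrow> W f y (f y)"
proof -
  let ?Q = "\<lambda>f y P. admissible f y P \<and> ((\<exists>P'. admissible f y P' \<and> W f y P') \<longrightarrow> W f y P)"
  have "\<exists>f. \<forall>y. ?Q f y (f y)"
  proof (rule dependent_wf_choice)
    have "{(x, y). lev x < lev y} = inv_image {(a, b). a < b} lev" by (auto simp: inv_image_def)
    then show "wf {(x, y). lev x < lev y}" by (metis wf wf_inv_image)
  next
    fix f g :: "node \<Rightarrow> node set" and y P
    assume "\<And>z. (z, y) \<in> {(x, y). lev x < lev y} \<Longrightarrow> f z = g z"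
    then have eq: "\<And>z. lev z < lev y \<Longrightarrow> f z = g z" by simp
    then have "admissible f y P' = admissible g y P'" for P'
      by (rule admissible_cong)
    moreover have "W f y P' = W g y P'" for P' using W eq by blast
    ultimately show "?Q f y P = ?Q g y P" by simp
  next
    fix y and f :: "node \<Rightarrow> node set"
    assume "\<And>z. (z, y) \<in> {(x, y). lev x < lev y} \<Longrightarrow> ?Q f z (f z)"
    then have "admissible f z (f z)" if "lev z < lev y" for z
      using that by simp
    then have "tree_on f {..<lev y}"
      unfolding tree_on_def by (auto dest: less_trans)
    then interpret tree_on f "{..<lev y}" .
    obtain P where "admissible f y P"
      using admissible_exists by blast
    then show "\<exists>P. ?Q f y P"
      by (cases "\<exists>P. admissible f y P \<and> W f y P") auto
  qed
  then obtain f where Q: "\<And>y. ?Q f y (f y)" by auto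
  show ?thesis
  proof (rule that[of f])
    show "admissible f y (f y)" for y using Q by simp
    show "W f y (f y)" if "admissible f y P" "W f y P" for y P
      using Q[of y] that by auto
  qed
qed

section \<open>Convergence and oscillation of guessed maps\<close>

definition converges :: "'b set \<Rightarrow> ('b \<Rightarrow> 'b \<Rightarrow> real) \<Rightarrow> (node \<Rightarrow> 'b) \<Rightarrow> w1 \<Rightarrow> node set \<Rightarrow> bool" where
  "converges B d \<psi> \<alpha> P \<longleftrightarrow>
     (\<exists>b\<in>B. \<forall>\<epsilon>>0. \<exists>\<beta><\<alpha>. \<forall>x\<in>P. \<beta> < lev x \<longrightarrow> d (\<psi> x) b < \<epsilon>)"

text \<open>
  The oscillation is taken over the nodes below the level of \<open>y\<close> only, so that genericity of a branch
  can be decided when \<open>y\<close> is put into the tree.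
\<close>

definition generic ::
  "('b \<Rightarrow> 'b \<Rightarrow> real) \<Rightarrow> (node \<Rightarrow> node set) \<Rightarrow> (node \<Rightarrow> 'b) \<Rightarrow> node \<Rightarrow> node set \<Rightarrow> bool" where
  "generic d f \<psi> y P \<longleftrightarrow>
     (\<forall>n. \<exists>z\<in>P. \<forall>v w. ext f z v \<longrightarrow> ext f z w \<longrightarrow> lev v < lev y \<longrightarrow> lev w < lev y \<longrightarrow>
        rho v < rho y \<longrightarrow> rho w < rho y \<longrightarrow> d (\<psi> v) (\<psi> w) < inverse (Suc n))"

text \<open>
  What the construction guarantees at a limit level where the guess of \<open>\<psi>\<close> is correct, if \<open>\<psi>\<close> is
  continuous.
\<close>

definition good_level ::
  "'b set \<Rightarrow> ('b \<Rightarrow> 'b \<Rightarrow> real) \<Rightarrow> (node \<Rightarrow> node set) \<Rightarrow> (node \<Rightarrow> 'b) \<Rightarrow> w1 \<Rightarrow> bool" where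
  "good_level B d f \<psi> \<alpha> \<longleftrightarrow> limit \<alpha> \<and>
     (\<forall>y P. lev y = \<alpha> \<longrightarrow> admissible f y P \<longrightarrow> converges B d \<psi> \<alpha> P) \<and>
     (\<forall>y P. lev y = \<alpha> \<longrightarrow> admissible f y P \<longrightarrow> generic d f \<psi> y P \<longrightarrow> generic d f \<psi> y (f y))"

text \<open>
  A continuous map with discrete fibres on the finished tree, with the topological properties spelled
  out at limit levels, which are the only places where the tree topology is not discrete. The last
  assumption is all that is used of diamond.
\<close>

locale guessed_map = Metric_space B d + tree_on f "UNIV :: w1 set"
  for B :: "'b set" and d f +
  fixes \<psi> :: "node \<Rightarrow> 'b"
  assumes \<psi>_in: "\<And>x. \<psi> x \<in> B"
    and \<psi>_cont: "\<And>y \<epsilon>. limit (lev y) \<Longrightarrow> \<epsilon> > 0 \<Longrightarrow>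
      \<exists>\<beta><lev y. \<forall>x\<in>f y. \<beta> < lev x \<longrightarrow> d (\<psi> x) (\<psi> y) < \<epsilon>"
    and \<psi>_fibre: "\<And>y. limit (lev y) \<Longrightarrow> \<exists>\<beta><lev y. \<forall>x\<in>f y. \<beta> < lev x \<longrightarrow> \<psi> x \<noteq> \<psi> y"
    and guess: "\<And>F. (\<And>x. countable (F x)) \<Longrightarrow>
      \<exists>\<alpha>. good_level B d f \<psi> \<alpha> \<and> (\<forall>x. lev x < \<alpha> \<longrightarrow> (\<forall>y\<in>F x. lev y < \<alpha>))"
begin

lemma good_limit: "good_level B d f \<psi> \<alpha> \<Longrightarrow> limit \<alpha>"
  by (simp add: good_level_def)

lemma limit_next:
  assumes "limit \<alpha>" "\<beta> < \<alpha>"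
  obtains \<gamma> where "\<gamma> < \<alpha>" "\<beta> < \<gamma>"
  using assms unfolding limit_def by blast

text \<open>
  The branch \<open>P\<close> is admissible for a node of level \<open>\<alpha>\<close> and coordinate \<open>q\<close> whose target is a node of
  \<open>P\<close>.
\<close>

lemma bounded_branch_converges:
  assumes good: "good_level B d f \<psi> \<alpha>" and P: "branch f \<alpha> P" "\<And>w. w \<in> P \<Longrightarrow> rho w < q"
  shows "converges B d \<psi> \<alpha> P"
proof -
  obtain \<beta> where "\<beta> < \<alpha>" using good_limit[OF good] unfolding limit_def by blast
  then obtain x where x: "x \<in> P" "lev x = \<beta>" by (rule branch_level[OF P(1)])
  obtain y where y: "lev y = \<alpha>" "rho y = q" "target y = x"
    using branch_lev[OF P(1) x(1)] by (rule target_surj)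
  have "admissible f y P"
    unfolding admissible_def using P x y by simp
  then show ?thesis using good y unfolding good_level_def by blast
qed

text \<open>
  The form in which elementary submodels enter: the nodes below \<open>\<alpha>\<close> are closed under Skolem functions
  for the countably many relations \<open>Q c\<close>. Two witnesses are needed where a condition is split in two.
\<close>

lemma reflecting_level:
  fixes Q :: "'c::countable \<Rightarrow> node \<Rightarrow> node \<Rightarrow> node \<Rightarrow> bool"
  obtains \<alpha> where "good_level B d f \<psi> \<alpha>" "lev x0 < \<alpha>"
    "\<And>c x y z. lev x < \<alpha> \<Longrightarrow> Q c x y z \<Longrightarrow> \<exists>y z. lev y < \<alpha> \<and> lev z < \<alpha> \<and> Q c x y z"
proof -
  have "\<exists>s. (\<exists>y z. Q c x y z) \<longrightarrow> Q c x (fst s) (snd s)" for c x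
    by auto
  then obtain s where s: "\<And>c x. (\<exists>y z. Q c x y z) \<Longrightarrow> Q c x (fst (s c x)) (snd (s c x))"
    by metis
  define F where "F x = insert x0 (range (\<lambda>c. fst (s c x)) \<union> range (\<lambda>c. snd (s c x)))" for x
  have "countable (F x)" for x
    unfolding F_def by (intro countable_insert countable_Un countable_image countableI_type)
  then obtain \<alpha> where \<alpha>: "good_level B d f \<psi> \<alpha>" and F: "\<And>x y. lev x < \<alpha> \<Longrightarrow> y \<in> F x \<Longrightarrow> lev y < \<alpha>"
    using guess[of F] by blast
  obtain \<beta> where "\<beta> < \<alpha>" using good_limit[OF \<alpha>] unfolding limit_def by blast
  then have "lev x0 < \<alpha>" using F[of "Node \<beta> 0 0" x0] by (simp add: F_def)
  moreover have "\<exists>y z. lev y < \<alpha> \<and> lev z < \<alpha> \<and> Q c x y z" if "lev x < \<alpha>" "Q c x y z" for c x y z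
  proof -
    have "Q c x (fst (s c x)) (snd (s c x))" using s that(2) by blast
    moreover have "lev (fst (s c x)) < \<alpha>" "lev (snd (s c x)) < \<alpha>"
      using F[OF that(1)] by (auto simp: F_def)
    ultimately show ?thesis by blast
  qed
  ultimately show ?thesis using that[OF \<alpha>] by blast
qed

definition osc_less :: "node \<Rightarrow> rat \<Rightarrow> real \<Rightarrow> bool" where
  "osc_less z q \<epsilon> \<longleftrightarrow>
     (\<forall>v w. ext f z v \<longrightarrow> ext f z w \<longrightarrow> rho v < q \<longrightarrow> rho w < q \<longrightarrow> d (\<psi> v) (\<psi> w) < \<epsilon>)"

lemma osc_lessD:
  "osc_less z q \<epsilon> \<Longrightarrow> ext f z v \<Longrightarrow> ext f z w \<Longrightarrow> rho v < q \<Longrightarrow> rho w < q \<Longrightarrow> d (\<psi> v) (\<psi> w) < \<epsilon>"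
  unfolding osc_less_def by blast

lemma ext_refl: "ext f x x"
  by (simp add: ext_def)

lemmas ext_tr = ext_trans[OF UNIV_I]

text \<open>
  If each node above \<open>x\<close> with coordinate below \<open>q\<close> had two such nodes above it whose values
  differ by at least \<open>\<epsilon>\<close>, then the value at one of them would differ by at least \<open>\<epsilon> / 2\<close> from the value
  at the node itself. Moving to it again and again produces a branch with coordinates below \<open>q\<close> on
  which \<open>\<psi>\<close> does not converge.
\<close>

lemma small_oscillation_dense:
  assumes x: "rho x < q" and \<epsilon>: "\<epsilon> > 0"
  shows "\<exists>z. ext f x z \<and> rho z < q \<and> osc_less z q \<epsilon>"
proof (rule ccontr)
  assume neg: "\<not> ?thesis"
  let ?Q = "\<lambda>(c::unit) z v w. ext f z v \<and> ext f z w \<and> rho v < q \<and> rho w < q \<and> \<epsilon> \<le> d (\<psi> v) (\<psi> w)"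
  obtain \<alpha> where \<alpha>: "good_level B d f \<psi> \<alpha>" "lev x < \<alpha>" and
    refl: "\<And>c z v w. lev z < \<alpha> \<Longrightarrow> ?Q c z v w \<Longrightarrow> \<exists>v w. lev v < \<alpha> \<and> lev w < \<alpha> \<and> ?Q c z v w"
    using reflecting_level[of x ?Q] by blast
  \<comment> \<open>By reflection the oscillating pairs can be found below level \<open>\<alpha>\<close>.\<close>
  have pair: "\<exists>v w. lev v < \<alpha> \<and> lev w < \<alpha> \<and> ?Q () z v w"
    if z: "ext f x z" "rho z < q" "lev z < \<alpha>" for z
  proof -
    have "\<not> osc_less z q \<epsilon>" using neg z by blast
    then obtain v w where "?Q () z v w" unfolding osc_less_def not_less[symmetric] by blast
    then show ?thesis by (rule refl[OF z(3)])
  qed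
  let ?a = "from_nat_into {..<\<alpha>}"
  have a: "?a n < \<alpha>" for n
    using from_nat_into[of "{..<\<alpha>}" n] \<alpha>(2) by auto
  define G where "G n = {u. \<exists>z. ext f z u \<and> ?a n \<le> lev z \<and> \<epsilon> / 2 \<le> d (\<psi> u) (\<psi> z)}" for n
  have dense: "\<exists>z'\<in>G n. ext f z z' \<and> lev z' < \<alpha> \<and> rho z' < q"
    if z: "ext f x z" "lev z < \<alpha>" "rho z < q" for n z
  proof -
    obtain z' where z': "ext f z z'" "lev z' < \<alpha>" "rho z' < q" "?a n \<le> lev z'"
      using climb[OF _ z(2,3) a[of n]] by blast
    obtain v w where vw: "lev v < \<alpha>" "lev w < \<alpha>" "?Q () z' v w"
      using pair[of z'] z z' ext_tr by blast
    have "d (\<psi> v) (\<psi> w) \<le> d (\<psi> v) (\<psi> z') + d (\<psi> w) (\<psi> z')"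
      using triangle[of "\<psi> v" "\<psi> z'" "\<psi> w"] \<psi>_in by (simp add: commute)
    then have "\<epsilon> / 2 \<le> d (\<psi> v) (\<psi> z') \<or> \<epsilon> / 2 \<le> d (\<psi> w) (\<psi> z')"
      using vw(3) by linarith
    then obtain u where u: "lev u < \<alpha>" "ext f z' u" "rho u < q" "\<epsilon> / 2 \<le> d (\<psi> u) (\<psi> z')"
      using vw by blast
    then have "u \<in> G n" using z'(4) unfolding G_def by blast
    then show ?thesis
      using u z'(1) ext_tr by blast
  qed
  obtain P where P: "branch f \<alpha> P" "x \<in> P" "\<And>w. w \<in> P \<Longrightarrow> rho w < q" "\<And>n. P \<inter> G n \<noteq> {}"
    using generic_branch[where G = G, OF subset_UNIV \<alpha>(2) x dense] by auto
  obtain b where b: "b \<in> B" "\<And>\<epsilon>. \<epsilon> > 0 \<Longrightarrow> \<exists>\<beta><\<alpha>. \<forall>x\<in>P. \<beta> < lev x \<longrightarrow> d (\<psi> x) b < \<epsilon>"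
    using bounded_branch_converges[OF \<alpha>(1) P(1,3)] unfolding converges_def by blast
  obtain \<beta> where \<beta>: "\<beta> < \<alpha>" "\<And>x. x \<in> P \<Longrightarrow> \<beta> < lev x \<Longrightarrow> d (\<psi> x) b < \<epsilon> / 4"
    using b(2)[of "\<epsilon> / 4"] \<epsilon> by auto
  obtain \<gamma> where \<gamma>: "\<gamma> < \<alpha>" "\<beta> < \<gamma>" using limit_next[OF good_limit[OF \<alpha>(1)] \<beta>(1)] .
  obtain n where n: "?a n = \<gamma>"
    using from_nat_into_surj[OF countable_lessThan_w1, of \<gamma> \<alpha>] \<gamma>(1) by auto
  obtain u z where u: "u \<in> P" "ext f z u" "\<gamma> \<le> lev z" "\<epsilon> / 2 \<le> d (\<psi> u) (\<psi> z)"
    using P(4)[of n] n unfolding G_def by blast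
  have z: "z \<in> P" using branch_down[OF P(1)] u by blast
  have "\<beta> < lev z" "\<beta> < lev u" using \<gamma>(2) u(3) ext_lev[OF _ u(2)] by auto
  then have "d (\<psi> u) b < \<epsilon> / 4" "d (\<psi> z) b < \<epsilon> / 4" using \<beta>(2) u(1) z by blast+
  moreover have "d (\<psi> u) (\<psi> z) \<le> d (\<psi> u) b + d (\<psi> z) b"
    using triangle[of "\<psi> u" b "\<psi> z"] \<psi>_in b(1) by (simp add: commute)
  ultimately show False using u(4) by linarith
qed

text \<open>
  Density of small oscillation makes a generic admissible branch available to \<open>y\<close>, and then \<open>y\<close> sits
  on one by its preference.
\<close>

lemma good_level_generic:
  assumes good: "good_level B d f \<psi> \<alpha>" and y: "lev y = \<alpha>"
    and dense: "\<And>n z q. lev z < \<alpha> \<Longrightarrow> rho z < q \<Longrightarrow>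
      \<exists>z'. ext f z z' \<and> lev z' < \<alpha> \<and> rho z' < q \<and> osc_less z' q (inverse (Suc n))"
  shows "generic d f \<psi> y (f y)"
proof -
  obtain \<beta> where "\<beta> < lev y" using good_limit[OF good] y unfolding limit_def by blast
  then obtain x where x: "lev x < lev y" "rho x < rho y"
    "lev (target y) < lev y \<and> rho (target y) < rho y \<longrightarrow> x = target y"
    by (rule admissible_start)
  define G where "G n = {z. osc_less z (rho y) (inverse (Suc n))}" for n
  have dense': "\<exists>z'\<in>G n. ext f z z' \<and> lev z' < \<alpha> \<and> rho z' < rho y"
    if "ext f x z" "lev z < \<alpha>" "rho z < rho y" for n z
    using dense[OF that(2,3), of n] unfolding G_def by blast
  have "lev x < \<alpha>" using x(1) y by simp
  then obtain P where P: "branch f \<alpha> P" "x \<in> P" "\<And>w. w \<in> P \<Longrightarrow> rho w < rho y"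
    "\<And>n. P \<inter> G n \<noteq> {}"
    using generic_branch[where G = G, OF subset_UNIV _ x(2) dense'] by auto
  have "target y \<in> P" if "lev (target y) < lev y \<and> rho (target y) < rho y"
    using P(2) x(3) that by simp
  then have "admissible f y P"
    unfolding admissible_def using P y by simp
  moreover have "generic d f \<psi> y P"
    unfolding generic_def
  proof (intro allI)
    fix n
    obtain z where z: "z \<in> P" "osc_less z (rho y) (inverse (Suc n))" using P(4)[of n] unfolding G_def by blast
    then show "\<exists>z\<in>P. \<forall>v w. ext f z v \<longrightarrow> ext f z w \<longrightarrow> lev v < lev y \<longrightarrow> lev w < lev y \<longrightarrow>
        rho v < rho y \<longrightarrow> rho w < rho y \<longrightarrow> d (\<psi> v) (\<psi> w) < inverse (Suc n)"
      unfolding osc_less_def by blast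
  qed
  ultimately show ?thesis using good y unfolding good_level_def by blast
qed

section \<open>Essential values\<close>

text \<open>
  A point \<open>c\<close> of which the map cannot get rid by passing to a subcondition of \<open>(x, q)\<close>.
  The bound \<open>r\<close> must be allowed to shrink below \<open>q\<close>, since the branch below a node \<open>y\<close> is generic for the
  bound \<open>rho y\<close> only.
\<close>

definition essential_value :: "node \<Rightarrow> rat \<Rightarrow> 'b \<Rightarrow> bool" where
  "essential_value x q c \<longleftrightarrow> c \<in> B \<and>
     (\<forall>z r n. ext f x z \<longrightarrow> r \<le> q \<longrightarrow> rho z < r \<longrightarrow>
        (\<exists>z'. ext f z z' \<and> rho z' < r \<and> d (\<psi> z') c < inverse (Suc n)))"

text \<open>
  Consider a node \<open>y\<close> above \<open>x\<close> with coordinate at most \<open>q\<close> on a good level that is closed under the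
  relevant witnesses. On its generic branch there is a node above which \<open>\<psi>\<close> varies little, and since
  values near \<open>c\<close> occur above it, \<open>\<psi>\<close> is near \<open>c\<close> on the rest of the branch. So \<open>\<psi> y = c\<close> by
  continuity. Now take a node \<open>y\<close> above \<open>x\<close> on a level that is a limit of such levels: the value \<open>c\<close>
  is attained cofinally below \<open>y\<close>, hence also at \<open>y\<close>, and the fibre of \<open>c\<close> is not discrete.
\<close>

lemma no_essential_value:
  assumes x: "rho x < q" and c: "essential_value x q c"
  shows False
proof -
  have cB: "c \<in> B" using c by (simp add: essential_value_def)
  \<comment> \<open>The Boolean selects which of two kinds of witnesses is reflected: nodes of small oscillation, or nodes with values near \<open>c\<close>.\<close>
  let ?Q = "\<lambda>(b, r, n) z z' (z''::node). ext f z z' \<and> rho z' < r \<and>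
    (if b then osc_less z' r (inverse (Suc n)) else d (\<psi> z') c < inverse (Suc n))"
  define good where "good \<alpha> \<longleftrightarrow> good_level B d f \<psi> \<alpha> \<and> lev x < \<alpha> \<and>
    (\<forall>c z y y'. lev z < \<alpha> \<longrightarrow> ?Q c z y y' \<longrightarrow> (\<exists>y y'. lev y < \<alpha> \<and> lev y' < \<alpha> \<and> ?Q c z y y'))" for \<alpha>
  have ex_good: "\<exists>\<alpha>. good \<alpha> \<and> lev v < \<alpha>" for v
  proof -
    let ?v = "Node (max (lev v) (lev x)) 0 0"
    obtain \<alpha> where \<alpha>: "good_level B d f \<psi> \<alpha>" "lev ?v < \<alpha>"
      "\<And>a z y y'. lev z < \<alpha> \<Longrightarrow> ?Q a z y y' \<Longrightarrow> \<exists>y y'. lev y < \<alpha> \<and> lev y' < \<alpha> \<and> ?Q a z y y'"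
      using reflecting_level[of ?v ?Q] by blast
    then have "good \<alpha>" unfolding good_def by auto
    then show ?thesis using \<alpha>(2) by auto
  qed
  have attained: "\<psi> y = c" if good: "good (lev y)" and xy: "x \<in> f y" and q: "rho y \<le> q" for y
  proof -
    have lev: "good_level B d f \<psi> (lev y)" "lev x < lev y" using good by (auto simp: good_def)
    have refl: "\<exists>v. lev v < lev y \<and> ?Q a z v x" if z: "lev z < lev y" "?Q a z z' x" for a z z'
    proof -
      obtain v w where "lev v < lev y" "?Q a z v w"
        using good z unfolding good_def by blast
      then show ?thesis by (cases a) auto
    qed
    have gen: "generic d f \<psi> y (f y)"
    proof (rule good_level_generic[OF lev(1) HOL.refl])
      fix n z r assume z: "lev z < lev y" "rho z < r"
      obtain z' where "ext f z z'" "rho z' < r" "osc_less z' r (inverse (Suc n))"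
        using small_oscillation_dense[OF z(2), of "inverse (Suc n)"] by auto
      then show "\<exists>z'. ext f z z' \<and> lev z' < lev y \<and> rho z' < r \<and> osc_less z' r (inverse (Suc n))"
        using refl[OF z(1), of "(True, r, n)" z'] by auto
    qed
    have le: "d (\<psi> y) c \<le> \<epsilon>" if \<epsilon>: "\<epsilon> > 0" for \<epsilon>
    proof -
      obtain n where n: "inverse (real (Suc n)) < \<epsilon> / 3"
        using reals_Archimedean[of "\<epsilon> / 3"] \<epsilon> by auto
      obtain z where z: "z \<in> f y"
        "\<And>v w. ext f z v \<Longrightarrow> ext f z w \<Longrightarrow> lev v < lev y \<Longrightarrow> lev w < lev y \<Longrightarrow>
          rho v < rho y \<Longrightarrow> rho w < rho y \<Longrightarrow> d (\<psi> v) (\<psi> w) < inverse (Suc n)"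
        using gen unfolding generic_def by blast
      obtain \<beta> where \<beta>: "\<beta> < lev y" "\<And>x. x \<in> f y \<Longrightarrow> \<beta> < lev x \<Longrightarrow> d (\<psi> x) (\<psi> y) < \<epsilon> / 3"
        using \<psi>_cont[OF good_limit[OF lev(1)], of "\<epsilon> / 3"] \<epsilon> by auto
      \<comment> \<open>The node \<open>u\<close> is so high on the branch that \<open>\<psi> u\<close> is close both to \<open>\<psi> y\<close> and to all values above \<open>u\<close>.\<close>
      have "max \<beta> (max (lev z) (lev x)) < lev y"
        using \<beta>(1) lev(2) lev_f[OF _ z(1)] by simp
      then obtain \<gamma> where \<gamma>: "\<gamma> < lev y" "max \<beta> (max (lev z) (lev x)) < \<gamma>"
        by (rule limit_next[OF good_limit[OF lev(1)]])
      obtain u where u: "u \<in> f y" "lev u = \<gamma>"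
        using branch_level[OF branch_f \<gamma>(1)] by auto
      have zu: "ext f z u" "ext f x u"
        using branch_chain[OF branch_f[OF UNIV_I]] z(1) xy u \<gamma>(2) by auto
      have ru: "rho u < rho y" using rho_f u(1) by blast
      obtain z' where z': "ext f u z'" "rho z' < rho y" "d (\<psi> z') c < inverse (Suc n)"
        using c zu(2) q ru unfolding essential_value_def by blast
      then obtain v where v: "lev v < lev y" "ext f u v" "rho v < rho y" "d (\<psi> v) c < inverse (Suc n)"
        using refl[of u "(False, rho y, n)" z'] u \<gamma>(1) by auto
      have "d (\<psi> u) (\<psi> v) < inverse (Suc n)"
        using z(2)[of u v] zu(1) v ru u \<gamma>(1) ext_tr by blast
      moreover have "d (\<psi> u) (\<psi> y) < \<epsilon> / 3"
        using \<beta>(2)[OF u(1)] \<gamma>(2) u(2) by simp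
      moreover have "d (\<psi> y) c \<le> d (\<psi> u) (\<psi> y) + d (\<psi> u) c"
        using triangle[of "\<psi> y" "\<psi> u" c] \<psi>_in cB by (simp add: commute)
      moreover have "d (\<psi> u) c \<le> d (\<psi> u) (\<psi> v) + d (\<psi> v) c"
        using triangle[of "\<psi> u" "\<psi> v" c] \<psi>_in cB by simp
      ultimately show ?thesis using n v(4) by linarith
    qed
    have "d (\<psi> y) c \<le> 0" by (rule field_le_epsilon) (use le in simp)
    then have "d (\<psi> y) c = 0" using nonneg[of "\<psi> y" c] by linarith
    then show ?thesis using zero \<psi>_in cB by blast
  qed
  \<comment> \<open>The second witness is a dummy, equal to the first.\<close>
  let ?Q\<beta> = "\<lambda>a z v w. a = () \<and> w = v \<and> lev z < lev v \<and> good (lev v)"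
  obtain \<beta> where \<beta>: "good_level B d f \<psi> \<beta>" "lev x < \<beta>"
    and refl: "\<And>a z v w. lev z < \<beta> \<Longrightarrow> ?Q\<beta> a z v w \<Longrightarrow>
      \<exists>v w. lev v < \<beta> \<and> lev w < \<beta> \<and> ?Q\<beta> a z v w"
    using reflecting_level[of x ?Q\<beta>] by blast
  have cofinal: "\<exists>\<alpha><\<beta>. \<gamma> < \<alpha> \<and> good \<alpha>" if "\<gamma> < \<beta>" for \<gamma>
  proof -
    obtain \<alpha> where "good \<alpha>" "\<gamma> < \<alpha>" using ex_good[of "Node \<gamma> 0 0"] by auto
    then show ?thesis
      using refl[of "Node \<gamma> 0 0" "()" "Node \<alpha> 0 0" "Node \<alpha> 0 0"] that by auto
  qed
  obtain r where r: "rho x < r" "r < q" using dense[OF x] by blast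
  obtain y where y: "lev y = \<beta>" "rho y = r" "target y = x"
    using \<beta>(2) by (rule target_surj)
  have xy: "x \<in> f y" using target_in_f[of y] y \<beta>(2) r(1) by simp
  have hit: "\<exists>u\<in>f y. \<gamma> < lev u \<and> \<psi> u = c" if \<gamma>: "\<gamma> < \<beta>" for \<gamma>
  proof -
    obtain \<alpha> where \<alpha>: "\<alpha> < \<beta>" "max \<gamma> (lev x) < \<alpha>" "good \<alpha>"
      using cofinal[of "max \<gamma> (lev x)"] \<gamma> \<beta>(2) by auto
    have "\<alpha> < lev y" using \<alpha>(1) y(1) by simp
    then obtain u where u: "u \<in> f y" "lev u = \<alpha>"
      by (rule branch_level[OF branch_f[OF UNIV_I]])
    have "x \<in> f u"
      using branch_below[OF branch_f u(1)] xy u \<alpha>(2) by auto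
    moreover have "rho u \<le> q"
      using rho_f[OF _ u(1)] y(2) r(2) by simp
    ultimately have "\<psi> u = c" using attained u(2) \<alpha>(3) by blast
    then show ?thesis using u \<alpha>(2) by auto
  qed
  have lim: "limit (lev y)" using good_limit \<beta>(1) y(1) by blast
  have le: "d c (\<psi> y) \<le> \<epsilon>" if \<epsilon>: "\<epsilon> > 0" for \<epsilon>
  proof -
    obtain \<gamma> where "\<gamma> < \<beta>" "\<And>u. u \<in> f y \<Longrightarrow> \<gamma> < lev u \<Longrightarrow> d (\<psi> u) (\<psi> y) < \<epsilon>"
      using \<psi>_cont[OF lim \<epsilon>] y(1) by blast
    then show ?thesis using hit[of \<gamma>] by fastforce
  qed
  have "d c (\<psi> y) \<le> 0" by (rule field_le_epsilon) (use le in simp)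
  then have "d c (\<psi> y) = 0" using nonneg[of c "\<psi> y"] by linarith
  then have "\<psi> y = c" using zero \<psi>_in cB by metis
  moreover obtain \<gamma> where "\<gamma> < \<beta>" "\<And>u. u \<in> f y \<Longrightarrow> \<gamma> < lev u \<Longrightarrow> \<psi> u \<noteq> \<psi> y"
    using \<psi>_fibre[OF lim] y(1) by blast
  ultimately show False using hit[of \<gamma>] by blast
qed

definition separated :: "node \<Rightarrow> rat \<Rightarrow> node \<Rightarrow> rat \<Rightarrow> bool" where
  "separated z r z' r' \<longleftrightarrow> (\<exists>\<delta>>0. \<forall>v w. ext f z v \<longrightarrow> ext f z' w \<longrightarrow> rho v < r \<longrightarrow> rho w < r' \<longrightarrow>
     \<delta> \<le> d (\<psi> v) (\<psi> w))"

text \<open>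
  Otherwise there is an essential value. Take a branch through \<open>x\<close> that contains nodes of arbitrarily
  small oscillation with respect to the bound \<open>q\<close>, and let \<open>c\<close> be the limit of \<open>\<psi>\<close> along it. For a
  subcondition of small oscillation, its image is not separated from the images of the
  conditions along the branch, and these shrink to \<open>c\<close>; so all of its values are near \<open>c\<close>.
\<close>

lemma splitting:
  assumes x: "rho x < q"
  shows "\<exists>z r z' r'. ext f x z \<and> r \<le> q \<and> rho z < r \<and> ext f x z' \<and> r' \<le> q \<and> rho z' < r' \<and>
    separated z r z' r'"
proof (rule ccontr)
  assume "\<not> ?thesis"
  then have nosplit: "\<not> separated z r z' r'"
    if "ext f x z" "r \<le> q" "rho z < r" "ext f x z'" "r' \<le> q" "rho z' < r'" for z r z' r'
    using that by blast
  let ?Q = "\<lambda>n z z' (z''::node). ext f z z' \<and> rho z' < q \<and> osc_less z' q (inverse (Suc n))"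
  obtain \<alpha> where \<alpha>: "good_level B d f \<psi> \<alpha>" "lev x < \<alpha>"
    "\<And>n z y y'. lev z < \<alpha> \<Longrightarrow> ?Q n z y y' \<Longrightarrow> \<exists>y y'. lev y < \<alpha> \<and> lev y' < \<alpha> \<and> ?Q n z y y'"
    using reflecting_level[of x ?Q] by blast
  define G where "G n = {z. osc_less z q (inverse (Suc n))}" for n
  have dense: "\<exists>z'\<in>G n. ext f z z' \<and> lev z' < \<alpha> \<and> rho z' < q"
    if z: "ext f x z" "lev z < \<alpha>" "rho z < q" for n z
  proof -
    obtain z' where "?Q n z z' x"
      using small_oscillation_dense[OF z(3), of "inverse (Suc n)"] by auto
    then show ?thesis
      using \<alpha>(3)[OF z(2)] unfolding G_def by blast
  qed
  obtain P where P: "branch f \<alpha> P" "x \<in> P" "\<And>w. w \<in> P \<Longrightarrow> rho w < q" "\<And>n. P \<inter> G n \<noteq> {}"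
    using generic_branch[where G = G, OF subset_UNIV \<alpha>(2) x dense] by auto
  obtain c where c: "c \<in> B" "\<And>\<epsilon>. \<epsilon> > 0 \<Longrightarrow> \<exists>\<beta><\<alpha>. \<forall>x\<in>P. \<beta> < lev x \<longrightarrow> d (\<psi> x) c < \<epsilon>"
    using bounded_branch_converges[OF \<alpha>(1) P(1,3)] unfolding converges_def by blast
  have "essential_value x q c"
    unfolding essential_value_def
  proof (intro conjI allI impI)
    fix z r n assume z: "ext f x z" "r \<le> q" "rho z < r"
    \<comment> \<open>The distance from \<open>\<psi> z'\<close> to \<open>c\<close> is estimated by four steps, via two nearly equal values \<open>\<psi> v\<close>, \<open>\<psi> w\<close> and a node \<open>u\<close> of the branch.\<close>
    define \<epsilon> where "\<epsilon> = inverse (real (Suc n)) / 4"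
    have \<epsilon>: "\<epsilon> > 0" by (simp add: \<epsilon>_def)
    obtain z' where z': "ext f z z'" "rho z' < r" "osc_less z' r \<epsilon>"
      using small_oscillation_dense[OF z(3) \<epsilon>] by blast
    obtain k where k: "inverse (real (Suc k)) < \<epsilon>"
      using reals_Archimedean[OF \<epsilon>] by auto
    obtain t where t: "t \<in> P" "osc_less t q (inverse (Suc k))"
      using P(4)[of k] unfolding G_def by blast
    obtain \<beta> where \<beta>: "\<beta> < \<alpha>" "\<And>x. x \<in> P \<Longrightarrow> \<beta> < lev x \<Longrightarrow> d (\<psi> x) c < \<epsilon>"
      using c(2)[OF \<epsilon>] by blast
    have "max (max (lev t) (lev x)) \<beta> < \<alpha>"
      using \<beta>(1) branch_lev[OF P(1) t(1)] \<alpha>(2) by simp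
    then obtain \<gamma> where \<gamma>: "\<gamma> < \<alpha>" "max (max (lev t) (lev x)) \<beta> < \<gamma>"
      by (rule limit_next[OF good_limit[OF \<alpha>(1)]])
    obtain u where u: "u \<in> P" "lev u = \<gamma>" using \<gamma>(1) by (rule branch_level[OF P(1)])
    have tu: "ext f t u" "ext f x u"
      using branch_chain[OF P(1)] t(1) P(2) u \<gamma>(2) by auto
    have "\<not> separated z' r u q"
      using nosplit[of z' r u q] z z' tu P(3)[OF u(1)] ext_tr by blast
    then obtain v w where vw: "ext f z' v" "ext f u w" "rho v < r" "rho w < q" "d (\<psi> v) (\<psi> w) < \<epsilon>"
      using \<epsilon> unfolding separated_def by (meson not_le)
    have "d (\<psi> z') (\<psi> v) < \<epsilon>"
      using osc_lessD[OF z'(3) ext_refl vw(1) z'(2) vw(3)] .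
    moreover have "d (\<psi> w) (\<psi> u) < inverse (Suc k)"
      using osc_lessD[OF t(2) ext_tr[OF tu(1) vw(2)] tu(1) vw(4) P(3)[OF u(1)]] .
    moreover have "d (\<psi> u) c < \<epsilon>" using \<beta>(2)[OF u(1)] u(2) \<gamma>(2) by simp
    moreover have "d (\<psi> z') c \<le> d (\<psi> z') (\<psi> v) + d (\<psi> v) c" "d (\<psi> v) c \<le> d (\<psi> v) (\<psi> w) + d (\<psi> w) c"
      "d (\<psi> w) c \<le> d (\<psi> w) (\<psi> u) + d (\<psi> u) c"
      using triangle \<psi>_in c(1) by blast+
    ultimately have "d (\<psi> z') c < 4 * \<epsilon>" using k vw(5) by linarith
    then show "\<exists>z'. ext f z z' \<and> rho z' < r \<and> d (\<psi> z') c < inverse (Suc n)"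
      using z' unfolding \<epsilon>_def by auto
  qed (rule c(1))
  then show False using no_essential_value[OF x] by blast
qed

end

section \<open>A Cantor subset of the target space\<close>

text \<open>
  A continuous injection of a compact space into a Hausdorff space is an embedding.
\<close>

lemma (in Metric_space) cantor_subset_range:
  fixes h :: "(nat \<Rightarrow> bool) \<Rightarrow> 'a"
  assumes M: "\<And>g. h g \<in> M" and inj: "inj h"
    and cont: "\<And>g \<epsilon>. \<epsilon> > 0 \<Longrightarrow> \<exists>n. \<forall>g'. (\<forall>i<n. g' i = g i) \<longrightarrow> d (h g) (h g') < \<epsilon>"
  shows "cantor_subset mtopology (range h)"
proof -
  have top: "topspace cantor_space = UNIV"
    by (simp add: cantor_space_def)
  have "continuous_map cantor_space mtopology h"
    unfolding continuous_map_to_metric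
  proof (intro ballI allI impI)
    fix g and \<epsilon> :: real assume "\<epsilon> > 0"
    then obtain n where n: "\<And>g'. (\<forall>i<n. g' i = g i) \<Longrightarrow> d (h g) (h g') < \<epsilon>"
      using cont by blast
    let ?X = "\<lambda>i. if i < n then {g i} else UNIV"
    have "openin cantor_space (PiE UNIV ?X)"
      unfolding cantor_space_def
    proof (rule product_topology_basis)
      have "{i. ?X i \<noteq> topspace (discrete_topology UNIV)} \<subseteq> {..<n}" by auto
      then show "finite {i. ?X i \<noteq> topspace (discrete_topology UNIV)}"
        by (rule finite_subset) simp
    qed simp
    moreover have "g \<in> PiE UNIV ?X" by auto
    moreover have "h g' \<in> mball (h g) \<epsilon>" if g': "g' \<in> PiE UNIV ?X" for g'
    proof -
      have "g' i = g i" if "i < n" for i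
        using PiE_mem[OF g', of i] that by simp
      then show ?thesis using n M by simp
    qed
    ultimately show "\<exists>U. openin cantor_space U \<and> g \<in> U \<and> (\<forall>g'\<in>U. h g' \<in> mball (h g) \<epsilon>)"
      by blast
  qed
  moreover have "compact_space cantor_space"
    unfolding cantor_space_def by (simp add: compact_space_product_topology compact_space_discrete_topology)
  ultimately have "embedding_map cantor_space mtopology h"
    using inj by (intro injective_closed_imp_embedding_map continuous_imp_closed_map_gen
      Hausdorff_imp_kc_space Hausdorff_space_mtopology) (simp_all add: top)
  then have "cantor_space homeomorphic_space subtopology mtopology (range h)"
    using embedding_map_imp_homeomorphic_space top by metis
  then show ?thesis
    unfolding cantor_subset_def using M homeomorphic_space_sym by auto
qed

context guessed_map
begin

lemma osc_less_ext: "osc_less z q \<epsilon> \<Longrightarrow> ext f z z' \<Longrightarrow> osc_less z' q \<epsilon>"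
  unfolding osc_less_def using ext_tr by blast

lemma separated_ext:
  "separated z r z' r' \<Longrightarrow> ext f z w \<Longrightarrow> ext f z' w' \<Longrightarrow> separated w r w' r'"
  unfolding separated_def using ext_tr by blast

lemma separated_sym: "separated z r z' r' \<Longrightarrow> separated z' r' z r"
  unfolding separated_def using commute by metis

text \<open>
  A Cantor scheme inside the levels below one good level \<open>\<alpha>\<close>. A point \<open>g\<close> of the Cantor space selects a
  decreasing sequence of conditions \<open>cs g n\<close>, which determines a bounded branch, and \<open>h g\<close> is the limit of
  \<open>\<psi>\<close> along this branch. Separation of the two halves at each step makes \<open>h\<close> injective, and
  oscillation tending to zero makes it continuous.
\<close>

lemma cantor_subset_exists: "\<exists>C. cantor_subset mtopology C"
proof -
  let ?x = "Node undefined 0 0"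
  \<comment> \<open>Reflected are the witnesses of small oscillation (\<open>Inl\<close>) and the separated pairs (\<open>Inr\<close>).\<close>
  let ?Q = "\<lambda>a z v w. case a of
      Inl (q, n) \<Rightarrow> ext f z v \<and> rho v < q \<and> osc_less v q (inverse (Suc n)) \<and> w = v
    | Inr (q, r, s) \<Rightarrow> ext f z v \<and> rho v < r \<and> ext f z w \<and> rho w < s \<and> separated v r w s"
  obtain \<alpha> where \<alpha>: "good_level B d f \<psi> \<alpha>" "lev ?x < \<alpha>" and
    refl: "\<And>(a :: rat \<times> nat + rat \<times> rat \<times> rat) z v w. lev z < \<alpha> \<Longrightarrow> ?Q a z v w \<Longrightarrow>
      \<exists>v w. lev v < \<alpha> \<and> lev w < \<alpha> \<and> ?Q a z v w"
    using reflecting_level[of ?x ?Q] by blast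
  let ?a = "from_nat_into {..<\<alpha>}"
  have a: "?a n < \<alpha>" for n
    using from_nat_into[of "{..<\<alpha>}" n] \<alpha>(2) by auto
  define valid where "valid c \<longleftrightarrow> lev (fst c) < \<alpha> \<and> rho (fst c) < snd c" for c :: "node \<times> rat"
  define le where "le c e \<longleftrightarrow> ext f (fst c) (fst e) \<and> snd e \<le> snd c" for c e :: "node \<times> rat"
  define small where "small n c \<longleftrightarrow> ?a n \<le> lev (fst c) \<and> osc_less (fst c) (snd c) (inverse (Suc n))"
    for n and c :: "node \<times> rat"
  \<comment> \<open>Shrink a condition below \<open>\<alpha>\<close> to one of oscillation less than \<open>1 / (n + 1)\<close> above the \<open>n\<close>-th level.\<close>
  have refine: "\<exists>z'. ext f z z' \<and> valid (z', q) \<and> small n (z', q)" if z: "lev z < \<alpha>" "rho z < q" for z q n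
  proof -
    obtain v where "ext f z v" "rho v < q" "osc_less v q (inverse (Suc n))"
      using small_oscillation_dense[OF z(2), of "inverse (Suc n)"] by auto
    then obtain u where u: "lev u < \<alpha>" "ext f z u" "rho u < q" "osc_less u q (inverse (Suc n))"
      using refl[OF z(1), of v v "Inl (q, n)"] by auto
    obtain z' where z': "ext f u z'" "lev z' < \<alpha>" "rho z' < q" "?a n \<le> lev z'"
      using climb[OF subset_UNIV u(1,3) a[of n]] .
    have "ext f z z'" using ext_tr[OF u(2) z'(1)] .
    moreover have "osc_less z' q (inverse (Suc n))" using osc_less_ext[OF u(4) z'(1)] .
    ultimately show ?thesis using z' unfolding valid_def small_def by auto
  qed
  define splits where "splits n c p \<longleftrightarrow> valid (fst p) \<and> valid (snd p) \<and> le c (fst p) \<and> le c (snd p) \<and>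
      small n (fst p) \<and> small n (snd p) \<and>
      separated (fst (fst p)) (snd (fst p)) (fst (snd p)) (snd (snd p))" for n c p
  have step: "\<exists>p. valid c \<longrightarrow> splits n c p" for n c
  proof (cases "valid c")
    case True
    obtain z q where c: "c = (z, q)" by (cases c)
    have z: "lev z < \<alpha>" "rho z < q" using True by (auto simp: valid_def c)
    obtain v r w s where "ext f z v" "r \<le> q" "rho v < r" "ext f z w" "s \<le> q" "rho w < s" "separated v r w s"
      using splitting[OF z(2)] by blast
    then obtain v w where v: "lev v < \<alpha>" "ext f z v" "rho v < r" and w: "lev w < \<alpha>" "ext f z w" "rho w < s"
      and sep: "separated v r w s" and q: "r \<le> q" "s \<le> q"
      using refl[OF z(1), of v w "Inr (q, r, s)"] by auto
    obtain v' where v': "ext f v v'" "valid (v', r)" "small n (v', r)" using refine v by blast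
    obtain w' where w': "ext f w w'" "valid (w', s)" "small n (w', s)" using refine w by blast
    have "le c (v', r)" "le c (w', s)"
      using ext_tr[OF v(2) v'(1)] ext_tr[OF w(2) w'(1)] q by (auto simp: le_def c)
    moreover have "separated v' r w' s" using separated_ext[OF sep v'(1) w'(1)] .
    ultimately show ?thesis using v' w' by (intro exI[of _ "((v', r), (w', s))"]) (simp add: splits_def)
  qed simp
  define S where "S n c = (SOME p. valid c \<longrightarrow> splits n c p)" for n c
  have S: "splits n c (S n c)" if "valid c" for n c
    using someI_ex[OF step[of c n]] that unfolding S_def by blast
  define cs where "cs g = rec_nat (?x, 1) (\<lambda>n c. if g n then fst (S n c) else snd (S n c))" for g :: "nat \<Rightarrow> bool"
  have cs_0: "cs g 0 = (?x, 1)" for g by (simp add: cs_def)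
  have cs_Suc: "cs g (Suc n) = (if g n then fst (S n (cs g n)) else snd (S n (cs g n)))" for g n
    by (simp add: cs_def)
  have valid: "valid (cs g n)" for g n
  proof (induction n)
    case 0 show ?case using \<alpha>(2) by (simp add: cs_0 valid_def)
  next
    case (Suc n) then show ?case using S[OF Suc, of n] by (simp add: cs_Suc splits_def)
  qed
  have le_Suc: "le (cs g n) (cs g (Suc n))" and small: "small n (cs g (Suc n))" for g n
    using S[OF valid[of g n], of n] by (simp_all add: cs_Suc splits_def)
  have le: "le (cs g m) (cs g n)" if "m \<le> n" for g m n
    using that
  proof (induction n rule: dec_induct)
    case base then show ?case by (simp add: le_def ext_refl)
  next
    case (step n)
    then show ?case using le_Suc[of g n] ext_tr unfolding le_def by (meson order_trans)
  qed
  have agree: "cs g n = cs g' n" if "\<forall>i<n. g' i = g i" for g g' n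
    using that by (induction n) (simp_all add: cs_0 cs_Suc)
  define P where "P g = {w. \<exists>n. ext f w (fst (cs g n))}" for g
  have P: "branch f \<alpha> (P g)" for g
    unfolding P_def
  proof (rule branch_of_chain[OF subset_UNIV])
    show "lev (fst (cs g n)) < \<alpha>" for n using valid[of g n] by (simp add: valid_def)
    show "ext f (fst (cs g n)) (fst (cs g (Suc n)))" for n using le_Suc[of g n] by (simp add: le_def)
    fix \<beta> assume "\<beta> < \<alpha>"
    then obtain n where "?a n = \<beta>"
      using from_nat_into_surj[OF countable_lessThan_w1, of \<beta> \<alpha>] by auto
    then have "\<beta> \<le> lev (fst (cs g (Suc n)))" using small[of n g] by (simp add: small_def)
    then show "\<exists>n. \<beta> \<le> lev (fst (cs g n))" by blast
  qed
  define cone where "cone c = {w. ext f (fst c) w \<and> rho w < snd c}" for c :: "node \<times> rat"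
  \<comment> \<open>The branch of \<open>g\<close> finally lies in each of its conditions.\<close>
  have in_cone: "w \<in> cone (cs g n)" if w: "w \<in> P g" "lev (fst (cs g n)) \<le> lev w" for g w n
  proof -
    obtain m where m: "ext f w (fst (cs g m))" using w(1) unfolding P_def by blast
    let ?k = "max m n"
    have k: "ext f (fst (cs g m)) (fst (cs g ?k))" "ext f (fst (cs g n)) (fst (cs g ?k))" "snd (cs g ?k) \<le> snd (cs g n)"
      using le[of m ?k g] le[of n ?k g] by (auto simp: le_def)
    have wk: "ext f w (fst (cs g ?k))" using ext_tr[OF m k(1)] .
    have "rho w \<le> rho (fst (cs g ?k))" using ext_rho[OF UNIV_I wk] .
    moreover have "rho (fst (cs g ?k)) < snd (cs g ?k)" using valid[of g ?k] by (simp add: valid_def)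
    moreover have "ext f (fst (cs g n)) w" using ext_comparable[OF UNIV_I k(2) wk w(2)] .
    ultimately show ?thesis using k(3) unfolding cone_def by simp
  qed
  have "\<exists>b\<in>B. \<forall>\<epsilon>>0. \<exists>\<beta><\<alpha>. \<forall>x\<in>P g. \<beta> < lev x \<longrightarrow> d (\<psi> x) b < \<epsilon>" for g
  proof -
    have "rho w < 1" if "w \<in> P g" for w
    proof -
      obtain n where n: "ext f w (fst (cs g n))" using \<open>w \<in> P g\<close> unfolding P_def by blast
      have "rho w \<le> rho (fst (cs g n))" using ext_rho[OF UNIV_I n] .
      also have "\<dots> < snd (cs g n)" using valid[of g n] by (simp add: valid_def)
      also have "\<dots> \<le> 1" using le[of 0 n g] by (simp add: le_def cs_0)
      finally show ?thesis .
    qed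
    then have "converges B d \<psi> \<alpha> (P g)"
      by (rule bounded_branch_converges[OF \<alpha>(1) P])
    then show ?thesis unfolding converges_def .
  qed
  then obtain h where hB: "\<And>g. h g \<in> B"
    and h: "\<And>g \<epsilon>. \<epsilon> > 0 \<Longrightarrow> \<exists>\<beta><\<alpha>. \<forall>x\<in>P g. \<beta> < lev x \<longrightarrow> d (\<psi> x) (h g) < \<epsilon>"
    by metis
  have near: "\<exists>w\<in>cone (cs g n). d (\<psi> w) (h g) < \<epsilon>" if \<epsilon>: "\<epsilon> > 0" for g n \<epsilon>
  proof -
    obtain \<beta> where \<beta>: "\<beta> < \<alpha>" "\<And>x. x \<in> P g \<Longrightarrow> \<beta> < lev x \<Longrightarrow> d (\<psi> x) (h g) < \<epsilon>"
      using h[OF \<epsilon>] by blast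
    have "max \<beta> (lev (fst (cs g n))) < \<alpha>" using \<beta>(1) valid[of g n] by (simp add: valid_def)
    then obtain \<gamma> where \<gamma>: "\<gamma> < \<alpha>" "max \<beta> (lev (fst (cs g n))) < \<gamma>"
      by (rule limit_next[OF good_limit[OF \<alpha>(1)]])
    obtain w where w: "w \<in> P g" "lev w = \<gamma>" using \<gamma>(1) by (rule branch_level[OF P])
    have "lev (fst (cs g n)) \<le> lev w" using \<gamma>(2) w(2) by (auto intro: less_imp_le)
    then have "w \<in> cone (cs g n)" by (rule in_cone[OF w(1)])
    then show ?thesis using \<beta>(2)[OF w(1)] \<gamma>(2) w(2) by auto
  qed
  have "cantor_subset mtopology (range h)"
  proof (rule cantor_subset_range[OF hB])
    show "inj h"
    proof (rule injI, rule ccontr)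
      fix g g' assume eq: "h g = h g'" and ne: "g \<noteq> g'"
      then have ex: "\<exists>n. g n \<noteq> g' n" by auto
      define n where "n = (LEAST n. g n \<noteq> g' n)"
      have n: "g n \<noteq> g' n" using LeastI_ex[OF ex] by (simp add: n_def)
      have "g' i = g i" if "i < n" for i
        using not_less_Least[of i "\<lambda>n. g n \<noteq> g' n"] that by (simp add: n_def)
      then have "\<forall>i<n. g' i = g i" by blast
      then have cs: "cs g n = cs g' n" by (rule agree)
      have "separated (fst (cs g (Suc n))) (snd (cs g (Suc n))) (fst (cs g' (Suc n))) (snd (cs g' (Suc n)))"
        using S[OF valid[of g n], of n] n separated_sym by (cases "g n") (simp_all add: cs_Suc cs splits_def)
      then obtain \<delta> where \<delta>: "\<delta> > 0"
        "\<And>v w. v \<in> cone (cs g (Suc n)) \<Longrightarrow> w \<in> cone (cs g' (Suc n)) \<Longrightarrow> \<delta> \<le> d (\<psi> v) (\<psi> w)"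
        unfolding separated_def cone_def by blast
      obtain v where v: "v \<in> cone (cs g (Suc n))" "d (\<psi> v) (h g) < \<delta> / 2"
        using near[of "\<delta> / 2" g "Suc n"] \<delta>(1) by auto
      obtain w where w: "w \<in> cone (cs g' (Suc n))" "d (\<psi> w) (h g') < \<delta> / 2"
        using near[of "\<delta> / 2" g' "Suc n"] \<delta>(1) by auto
      have "d (\<psi> v) (\<psi> w) \<le> d (\<psi> v) (h g) + d (\<psi> w) (h g)"
        using triangle[of "\<psi> v" "h g" "\<psi> w"] \<psi>_in hB by (simp add: commute)
      then show False using \<delta>(2)[OF v(1) w(1)] v(2) w(2) eq by simp
    qed
  next
    fix g and \<epsilon> :: real assume \<epsilon>: "\<epsilon> > 0"
    then obtain n where n: "inverse (real (Suc n)) < \<epsilon> / 3"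
      using reals_Archimedean[of "\<epsilon> / 3"] by auto
    show "\<exists>n. \<forall>g'. (\<forall>i<n. g' i = g i) \<longrightarrow> d (h g) (h g') < \<epsilon>"
    proof (intro exI allI impI)
      fix g' assume "\<forall>i<Suc n. g' i = g i"
      then have cs: "cs g (Suc n) = cs g' (Suc n)" by (rule agree)
      obtain v where v: "v \<in> cone (cs g (Suc n))" "d (\<psi> v) (h g) < \<epsilon> / 3"
        using near[of "\<epsilon> / 3" g "Suc n"] \<epsilon> by auto
      obtain w where w: "w \<in> cone (cs g (Suc n))" "d (\<psi> w) (h g') < \<epsilon> / 3"
        using near[of "\<epsilon> / 3" g' "Suc n"] \<epsilon> cs by auto
      have "d (\<psi> v) (\<psi> w) < inverse (Suc n)"
        using small[of n g] v(1) w(1) unfolding small_def osc_less_def cone_def by blast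
      moreover have "d (h g) (h g') \<le> d (\<psi> v) (h g) + d (\<psi> v) (h g')"
        using triangle[of "h g" "\<psi> v" "h g'"] \<psi>_in hB by (simp add: commute)
      moreover have "d (\<psi> v) (h g') \<le> d (\<psi> v) (\<psi> w) + d (\<psi> w) (h g')"
        using triangle[of "\<psi> v" "\<psi> w" "h g'"] \<psi>_in hB by simp
      ultimately show "d (h g) (h g') < \<epsilon>" using v(2) w(2) n by linarith
    qed
  qed
  then show ?thesis by blast
qed

end

section \<open>The tree on sets of natural numbers\<close>

lemma underS_omega1_ordLess:
  assumes "a < b"
  shows "Restr omega1 (underS omega1 (Rep_w1 a)) <o Restr omega1 (underS omega1 (Rep_w1 b))"
proof -
  interpret wo_rel omega1
    using Well_order_omega1 by (simp add: wo_rel_def)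
  have "{..<a} \<subset> {..<b}" using assms by auto
  then have "Rep_w1 ` {..<a} \<subset> Rep_w1 ` {..<b}"
    by (metis Rep_w1_inject inj_onI image_strict_mono subset_UNIV)
  then show ?thesis
    using ofilter_subset_ordLess[OF Well_order_omega1 underS_ofilter underS_ofilter]
    by (simp add: Rep_w1_image_lessThan)
qed

text \<open>
  The nodes are renamed by an injection into the type over which trees are quantified in the theorem.
\<close>

locale transported_tree = tree_on f "UNIV :: w1 set" for f +
  fixes j :: "node \<Rightarrow> nat set"
  assumes inj_j: "inj j"
begin

definition carrier :: "nat set set" where
  "carrier = range j"

definition tree_rel :: "nat set rel" where
  "tree_rel = {(j x, j y) |x y. x \<in> f y}"

lemma j_eq: "j x = j y \<longleftrightarrow> x = y"
  using inj_j by (simp add: inj_eq)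

lemma tree_rel_j: "(j x, j y) \<in> tree_rel \<longleftrightarrow> x \<in> f y"
  unfolding tree_rel_def by (auto simp: j_eq)

lemma down_j: "tree_down carrier tree_rel (j y) = j ` f y"
  unfolding tree_down_def carrier_def by (auto simp: tree_rel_j)

text \<open>
  The level of a node is its height: the nodes below \<open>y\<close> are a copy of the ordinals below \<open>lev y\<close>. Being
  an isomorphic image, the height is a well-order without further proof.
\<close>

lemma height_j:
  defines "h \<equiv> \<lambda>y s. j (inv_into (f y) lev (Abs_w1 s))"
  defines "\<sigma> \<equiv> \<lambda>y. Restr omega1 (underS omega1 (Rep_w1 (lev y)))"
  shows "inj_on (h y) (Field (\<sigma> y))" "tree_height carrier tree_rel (j y) = dir_image (\<sigma> y) (h y)"
proof -
  define node where "node \<beta> = inv_into (f y) lev \<beta>" for \<beta>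
  have node: "node \<beta> \<in> f y" "lev (node \<beta>) = \<beta>" if "\<beta> < lev y" for \<beta>
  proof -
    have "\<beta> \<in> lev ` f y" using branch_levels[OF branch_f[OF UNIV_I, of y]] that by simp
    then show "node \<beta> \<in> f y" "lev (node \<beta>) = \<beta>"
      unfolding node_def by (rule inv_into_into, rule f_inv_into_f)
  qed
  have node_lev: "node (lev v) = v" if "v \<in> f y" for v
    unfolding node_def by (rule inv_into_f_f[OF branch_inj[OF branch_f[OF UNIV_I]] that])
  have h: "h y (Rep_w1 \<beta>) = j (node \<beta>)" for \<beta>
    by (simp add: h_def node_def Rep_w1_inverse)
  have Field: "Field (\<sigma> y) \<subseteq> Rep_w1 ` {..<lev y}"
    unfolding \<sigma>_def Rep_w1_image_lessThan Field_def by blast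
  show "inj_on (h y) (Field (\<sigma> y))"
  proof (rule inj_on_subset[OF _ Field], rule inj_onI)
    fix s t assume "s \<in> Rep_w1 ` {..<lev y}" "t \<in> Rep_w1 ` {..<lev y}" and eq: "h y s = h y t"
    then obtain \<beta> \<gamma> where st: "s = Rep_w1 \<beta>" "\<beta> < lev y" "t = Rep_w1 \<gamma>" "\<gamma> < lev y" by blast
    then have "lev (node \<beta>) = lev (node \<gamma>)" using eq by (simp add: h j_eq)
    then show "s = t" unfolding node(2)[OF st(2)] node(2)[OF st(4)] st(1,3) by simp
  qed
  have "(s, t) \<in> tree_height carrier tree_rel (j y) \<longleftrightarrow>
      (\<exists>v w. v \<in> f y \<and> w \<in> f y \<and> lev v \<le> lev w \<and> s = j v \<and> t = j w)" for s t
  proof -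
    have le: "(v = w \<or> v \<in> f w) \<longleftrightarrow> lev v \<le> lev w" if "v \<in> f y" "w \<in> f y" for v w
      using branch_chain[OF branch_f[OF UNIV_I] that] ext_lev[OF UNIV_I, of v w] by (auto simp: ext_def)
    have "(s, t) \<in> tree_height carrier tree_rel (j y) \<longleftrightarrow>
        (\<exists>v w. v \<in> f y \<and> w \<in> f y \<and> (v = w \<or> v \<in> f w) \<and> s = j v \<and> t = j w)"
      unfolding tree_height_def down_j by (simp add: image_iff) (metis tree_rel_j j_eq)
    then show ?thesis using le by blast
  qed
  moreover have "(s, t) \<in> dir_image (\<sigma> y) (h y) \<longleftrightarrow>
      (\<exists>v w. v \<in> f y \<and> w \<in> f y \<and> lev v \<le> lev w \<and> s = j v \<and> t = j w)" for s t
  proof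
    assume "(s, t) \<in> dir_image (\<sigma> y) (h y)"
    then obtain a b where ab: "s = h y a" "t = h y b" "(a, b) \<in> omega1"
      "a \<in> Rep_w1 ` {..<lev y}" "b \<in> Rep_w1 ` {..<lev y}"
      unfolding dir_image_def \<sigma>_def Rep_w1_image_lessThan by blast
    then obtain \<beta> \<gamma> where "a = Rep_w1 \<beta>" "\<beta> < lev y" "b = Rep_w1 \<gamma>" "\<gamma> < lev y" by blast
    then show "\<exists>v w. v \<in> f y \<and> w \<in> f y \<and> lev v \<le> lev w \<and> s = j v \<and> t = j w"
      using ab node by (intro exI[of _ "node \<beta>"] exI[of _ "node \<gamma>"]) (simp add: h less_eq_w1_def)
  next
    assume "\<exists>v w. v \<in> f y \<and> w \<in> f y \<and> lev v \<le> lev w \<and> s = j v \<and> t = j w"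
    then obtain v w where vw: "v \<in> f y" "w \<in> f y" "lev v \<le> lev w" "s = j v" "t = j w" by blast
    have "s = h y (Rep_w1 (lev v))" "t = h y (Rep_w1 (lev w))"
      using vw node_lev by (simp_all add: h)
    moreover have "(Rep_w1 (lev v), Rep_w1 (lev w)) \<in> \<sigma> y"
      using vw lev_f[OF UNIV_I vw(1)] lev_f[OF UNIV_I vw(2)]
      by (simp add: \<sigma>_def less_eq_w1_def less_w1_def)
    ultimately show "(s, t) \<in> dir_image (\<sigma> y) (h y)"
      unfolding dir_image_def by blast
  qed
  ultimately show "tree_height carrier tree_rel (j y) = dir_image (\<sigma> y) (h y)"
    by auto
qed

lemma height_ordIso:
  "Restr omega1 (underS omega1 (Rep_w1 (lev y))) =o tree_height carrier tree_rel (j y)"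
  unfolding height_j(2)
  by (rule dir_image_ordIso[OF Well_order_Restr[OF Well_order_omega1] height_j(1)])

lemma same_height_same_lev:
  fixes \<alpha> :: "nat set rel"
  assumes "tree_height carrier tree_rel (j y) =o \<alpha>" "tree_height carrier tree_rel (j z) =o \<alpha>"
  shows "lev y = lev z"
proof -
  let ?\<sigma> = "\<lambda>y. Restr omega1 (underS omega1 (Rep_w1 (lev y)))"
  have iso: "?\<sigma> y =o ?\<sigma> z"
    using height_ordIso[of y] height_ordIso[of z] assms ordIso_transitive ordIso_symmetric by metis
  have "\<not> lev y < lev z"
    using underS_omega1_ordLess[of "lev y" "lev z"] iso not_ordLess_ordIso by blast
  moreover have "\<not> lev z < lev y"
    using underS_omega1_ordLess[of "lev z" "lev y"] iso not_ordLess_ordIso ordIso_symmetric by blast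
  ultimately show ?thesis by simp
qed

lemma is_tree_carrier: "is_tree carrier tree_rel"
  unfolding is_tree_def
proof (intro conjI ballI)
  show "tree_rel \<subseteq> carrier \<times> carrier"
  proof
    fix p assume "p \<in> tree_rel"
    then obtain x y where "p = (j x, j y)" unfolding tree_rel_def by blast
    then show "p \<in> carrier \<times> carrier" by (simp add: carrier_def)
  qed
  show "irrefl tree_rel"
  proof (rule irreflI)
    fix a show "(a, a) \<notin> tree_rel"
    proof
      assume "(a, a) \<in> tree_rel"
      then obtain x y where "a = j x" "a = j y" "x \<in> f y" unfolding tree_rel_def by blast
      then show False using lev_f[OF UNIV_I, of x x] by (simp add: j_eq)
    qed
  qed
  show "trans tree_rel"
  proof (rule transI)
    fix a b c assume "(a, b) \<in> tree_rel" "(b, c) \<in> tree_rel"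
    then obtain x y y' z where x: "a = j x" "b = j y" "x \<in> f y" and z: "b = j y'" "c = j z" "y' \<in> f z"
      unfolding tree_rel_def by blast
    have "y' = y" using x(2) z(1) by (simp add: j_eq)
    then show "(a, c) \<in> tree_rel" using f_trans[of z y x] x z by (simp add: tree_rel_j)
  qed
  fix x assume "x \<in> carrier"
  then obtain y where y: "x = j y" by (auto simp: carrier_def)
  have "Well_order (tree_height carrier tree_rel (j y))"
    unfolding height_j(2)
    by (rule Well_order_dir_image[OF Well_order_Restr[OF Well_order_omega1] height_j(1)])
  then show "well_order_on (tree_down carrier tree_rel x) (tree_height carrier tree_rel x)"
    by (simp add: y Field_tree_height)
qed

text \<open>
  The rational coordinate is strictly increasing, hence injective on chains and constant on no two
  comparable nodes.
\<close>

lemma special_aronszajn: "special_aronszajn_tree carrier tree_rel"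
proof -
  have "|carrier| =o omega1"
  proof -
    have "bij_betw j UNIV carrier" using inj_j by (simp add: bij_betw_def carrier_def)
    then have "|UNIV :: node set| =o |carrier|" using card_of_ordIso by blast
    then show ?thesis using card_of_node ordIso_symmetric ordIso_transitive by blast
  qed
  moreover have "countable (tree_level carrier tree_rel \<alpha>)" for \<alpha> :: "nat set rel"
  proof (cases "tree_level carrier tree_rel \<alpha> = {}")
    case False
    then obtain y where y: "tree_height carrier tree_rel (j y) =o \<alpha>"
      by (auto simp: tree_level_def carrier_def)
    have "tree_level carrier tree_rel \<alpha> \<subseteq> j ` {x. lev x = lev y}"
      using same_height_same_lev[OF _ y] by (auto simp: tree_level_def carrier_def)
    then show ?thesis
      using countable_level countable_image countable_subset by metis
  qed simp
  moreover have "tree_level carrier tree_rel omega1 = {}"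
  proof -
    have "\<not> tree_height carrier tree_rel (j y) =o omega1" for y
    proof
      assume "tree_height carrier tree_rel (j y) =o omega1"
      then have "Restr omega1 (underS omega1 (Rep_w1 (lev y))) =o omega1"
        by (rule ordIso_transitive[OF height_ordIso])
      moreover have "Restr omega1 (underS omega1 (Rep_w1 (lev y))) <o omega1"
        using underS_Restr_ordLess[OF Well_order_omega1] uncountable_Field_omega1
        by (metis countable_empty)
      ultimately show False using not_ordLess_ordIso by blast
    qed
    then show ?thesis by (auto simp: tree_level_def carrier_def)
  qed
  ultimately have omega1_tree: "omega1_tree carrier tree_rel"
    unfolding omega1_tree_def using is_tree_carrier by blast
  define q where "q t = rho (inv j t)" for t
  have q: "q (j x) = rho x" for x
    by (simp add: q_def inj_j)
  have q_less: "q a < q b" if "(a, b) \<in> tree_rel" for a b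
    using that rho_f[OF UNIV_I] unfolding tree_rel_def by (auto simp: q)
  have "countable C" if C: "tree_chain carrier tree_rel C" for C
  proof -
    have "inj_on q C"
    proof (rule inj_onI, rule ccontr)
      fix a b assume "a \<in> C" "b \<in> C" "q a = q b" "a \<noteq> b"
      then have "(a, b) \<in> tree_rel \<or> (b, a) \<in> tree_rel"
        using C unfolding tree_chain_def pairwise_def by blast
      then show False using q_less \<open>q a = q b\<close> by fastforce
    qed
    then show ?thesis by (rule countable_image_inj_on[rotated]) simp
  qed
  moreover
  define A where "A n = {t \<in> carrier. q t = from_nat_into UNIV n}" for n
  have "tree_antichain carrier tree_rel (A n)" for n
    unfolding tree_antichain_def pairwise_def A_def using q_less by fastforce
  moreover have "carrier = (\<Union>n. A n)"
  proof -
    have "\<exists>n. q t = from_nat_into UNIV n" for t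
      using from_nat_into_surj[of "UNIV :: rat set" "q t"] by (metis UNIV_I countableI_type)
    then show ?thesis unfolding A_def by blast
  qed
  ultimately show ?thesis
    unfolding special_aronszajn_tree_def aronszajn_tree_def using omega1_tree by blast
qed

text \<open>
  The only form in which the tree topology is used below: a neighbourhood of a node of limit level
  contains a final segment of its predecessors.
\<close>

lemma tree_open_limit:
  assumes U: "tree_open carrier tree_rel U" and y: "j y \<in> U" and lim: "limit (lev y)"
  shows "\<exists>\<beta><lev y. \<forall>x\<in>f y. \<beta> < lev x \<longrightarrow> j x \<in> U"
proof -
  have "nonzero_limit (tree_height carrier tree_rel (j y))"
    unfolding nonzero_limit_def Field_tree_height down_j
  proof (intro conjI ballI)
    obtain \<beta> where "\<beta> < lev y" using lim unfolding limit_def by blast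
    then show "j ` f y \<noteq> {}" using branch_level[OF branch_f[OF UNIV_I]] by blast
  next
    fix i assume "i \<in> j ` f y"
    then obtain v where v: "i = j v" "v \<in> f y" by blast
    then obtain \<gamma> where \<gamma>: "\<gamma> < lev y" "lev v < \<gamma>"
      using lim lev_f[OF UNIV_I] unfolding limit_def by blast
    obtain w where w: "w \<in> f y" "lev w = \<gamma>"
      using \<gamma>(1) by (rule branch_level[OF branch_f[OF UNIV_I]])
    have "ext f v w"
      using branch_chain[OF branch_f[OF UNIV_I] v(2) w(1)] \<gamma>(2) w(2) by (auto intro: less_imp_le)
    moreover have "v \<noteq> w" using \<gamma>(2) w(2) by blast
    ultimately have "j w \<noteq> i \<and> (i, j w) \<in> tree_height carrier tree_rel (j y)"
      using v w unfolding tree_height_def down_j by (auto simp: ext_def tree_rel_j j_eq)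
    then show "\<exists>k\<in>j ` f y. k \<noteq> i \<and> (i, k) \<in> tree_height carrier tree_rel (j y)"
      using w(1) by blast
  qed
  then obtain s where s: "s \<in> j ` f y" "tree_up carrier tree_rel s \<inter> j ` f y \<subseteq> U"
    using U y unfolding tree_open_def down_j[symmetric] by blast
  then obtain v where v: "s = j v" "v \<in> f y" by blast
  have "j x \<in> U" if x: "x \<in> f y" "lev v < lev x" for x
  proof -
    have "ext f v x" "v \<noteq> x"
      using branch_chain[OF branch_f[OF UNIV_I] v(2) x(1)] x(2) by (auto intro: less_imp_le)
    then have "j x \<in> tree_up carrier tree_rel s"
      unfolding tree_up_def by (auto simp: v ext_def tree_rel_j carrier_def)
    then show ?thesis using s(2) x(1) by blast
  qed
  then show ?thesis using lev_f[OF UNIV_I v(2)] by blast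
qed

lemma continuous_at_limit:
  assumes "Metric_space B d"
    and cont: "continuous_map (tree_topology carrier tree_rel) (Metric_space.mtopology B d) \<psi>"
    and lim: "limit (lev y)" and \<epsilon>: "\<epsilon> > 0"
  shows "\<exists>\<beta><lev y. \<forall>x\<in>f y. \<beta> < lev x \<longrightarrow> d (\<psi> (j x)) (\<psi> (j y)) < \<epsilon>"
proof -
  interpret Metric_space B d by fact
  have top: "topspace (tree_topology carrier tree_rel) = carrier"
    by (rule topspace_tree_topology[OF is_tree_carrier])
  let ?U = "{t \<in> carrier. \<psi> t \<in> mball (\<psi> (j y)) \<epsilon>}"
  have "openin (tree_topology carrier tree_rel) ?U"
    using cont openin_mball unfolding continuous_map_def top by blast
  then have "tree_open carrier tree_rel ?U"
    by (simp add: openin_tree_topology[OF is_tree_carrier])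
  moreover have "j y \<in> ?U"
  proof -
    have "j y \<in> carrier" by (simp add: carrier_def)
    moreover have "\<psi> (j y) \<in> B"
      using continuous_map_image_subset_topspace[OF cont] \<open>j y \<in> carrier\<close> by (auto simp: top)
    ultimately show ?thesis using \<epsilon> by simp
  qed
  ultimately obtain \<beta> where "\<beta> < lev y" "\<forall>x\<in>f y. \<beta> < lev x \<longrightarrow> j x \<in> ?U"
    using tree_open_limit[OF _ _ lim] by blast
  then show ?thesis by (auto simp: commute)
qed

lemma discrete_fibre_at_limit:
  assumes disc: "discrete_subset (tree_topology carrier tree_rel) {t \<in> carrier. \<psi> t = \<psi> (j y)}"
    and lim: "limit (lev y)"
  shows "\<exists>\<beta><lev y. \<forall>x\<in>f y. \<beta> < lev x \<longrightarrow> \<psi> (j x) \<noteq> \<psi> (j y)"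
proof -
  let ?S = "{t \<in> carrier. \<psi> t = \<psi> (j y)}"
  have "j y \<in> ?S" by (simp add: carrier_def)
  then have "openin (subtopology (tree_topology carrier tree_rel) ?S) {j y}"
    using disc unfolding discrete_subset_def by simp
  then obtain U where U: "openin (tree_topology carrier tree_rel) U" "{j y} = U \<inter> ?S"
    unfolding openin_subtopology by blast
  then have "tree_open carrier tree_rel U" "j y \<in> U"
    by (auto simp: openin_tree_topology[OF is_tree_carrier])
  then obtain \<beta> where \<beta>: "\<beta> < lev y" "\<And>x. x \<in> f y \<Longrightarrow> \<beta> < lev x \<Longrightarrow> j x \<in> U"
    using tree_open_limit[OF _ _ lim] by blast
  have "\<psi> (j x) \<noteq> \<psi> (j y)" if x: "x \<in> f y" "\<beta> < lev x" for x
  proof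
    assume "\<psi> (j x) = \<psi> (j y)"
    then have "j x \<in> U \<inter> ?S" using \<beta>(2)[OF x] by (simp add: carrier_def)
    then have "x = y" using U(2) j_eq by blast
    then show False using lev_f[OF UNIV_I x(1)] by simp
  qed
  then show ?thesis using \<beta>(1) by blast
qed

end

section \<open>The special Aronszajn tree without continuous maps with discrete fibres\<close>

lemma converges_cong:
  assumes "\<And>x. lev x < \<alpha> \<Longrightarrow> \<phi> x = \<psi> x" "branch f \<alpha> P"
  shows "converges B d \<phi> \<alpha> P \<longleftrightarrow> converges B d \<psi> \<alpha> P"
proof -
  have "\<phi> x = \<psi> x" if "x \<in> P" for x using assms branch_lev that by blast
  then show ?thesis unfolding converges_def by simp
qed

lemma generic_cong:
  assumes "\<And>x. lev x < lev y \<Longrightarrow> \<phi> x = \<psi> x" "\<And>x. lev x < lev y \<Longrightarrow> f x = g x"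
  shows "generic d f \<phi> y P \<longleftrightarrow> generic d g \<psi> y P"
proof -
  have "ext f z v \<longleftrightarrow> ext g z v" if "lev v < lev y" for z v
    using assms(2) that by (simp add: ext_def)
  then show ?thesis unfolding generic_def using assms(1) by (smt (verit))
qed

theorem theorem1p1:
  fixes B :: "'b set" and d :: "'b \<Rightarrow> 'b \<Rightarrow> real"
  assumes "diamond"
    and "Metric_space B d"
    and "\<not> (\<exists>C. cantor_subset (Metric_space.mtopology B d) C)"
    and "|B| \<le>o omega1"
  shows "\<exists>(T :: nat set set) (R :: nat set rel).
           special_aronszajn_tree T R \<and>
           \<not> (\<exists>\<psi> :: nat set \<Rightarrow> 'b.
                continuous_map (tree_topology T R) (Metric_space.mtopology B d) \<psi> \<and>
                (\<forall>b\<in>B. discrete_subset (tree_topology T R) {x\<in>T. \<psi> x = b}))"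
proof -
  obtain g :: "w1 \<Rightarrow> node \<Rightarrow> 'b" where g:
    "\<And>\<psi> F. (\<And>x. \<psi> x \<in> B) \<Longrightarrow> (\<And>x. countable (F x)) \<Longrightarrow>
       \<exists>\<alpha>. limit \<alpha> \<and> (\<forall>x. lev x < \<alpha> \<longrightarrow> (\<forall>y\<in>F x. lev y < \<alpha>)) \<and> (\<forall>x. lev x < \<alpha> \<longrightarrow> g \<alpha> x = \<psi> x)"
    using diamond_guesses_functions[OF assms(1,4)] by blast
  \<comment> \<open>Divergence comes first; genericity counts only if every admissible branch converges.\<close>
  define W where "W f y P \<longleftrightarrow> \<not> converges B d (g (lev y)) (lev y) P \<or>
    ((\<forall>P'. admissible f y P' \<longrightarrow> converges B d (g (lev y)) (lev y) P') \<and> generic d f (g (lev y)) y P)"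
    for f y P
  have W_cong: "W f y P = W f' y P" if eq: "\<And>x. lev x < lev y \<Longrightarrow> f x = f' x" for f f' y P
  proof -
    have "admissible f y Q = admissible f' y Q" for Q
      by (rule admissible_cong[OF eq])
    moreover have "generic d f (g (lev y)) y P = generic d f' (g (lev y)) y P"
      by (rule generic_cong[OF HOL.refl eq])
    ultimately show ?thesis by (simp add: W_def)
  qed
  obtain f where adm: "\<And>y. admissible f y (f y)"
    and W: "\<And>y P. admissible f y P \<Longrightarrow> W f y P \<Longrightarrow> W f y (f y)"
    using tree_with_preferences[of W, OF W_cong] by blast
  have "|UNIV :: node set| =o |Field omega1|"
    using card_of_node card_of_Field_ordIso[OF Card_order_omega1] ordIso_symmetric ordIso_transitive by blast
  then obtain j :: "node \<Rightarrow> nat set" where "bij_betw j UNIV (Field omega1)"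
    using card_of_ordIso by blast
  then have "inj j" by (simp add: bij_betw_def)
  interpret transported_tree f j
    by unfold_locales (use adm \<open>inj j\<close> in auto)
  have "\<not> (\<exists>\<psi> :: nat set \<Rightarrow> 'b.
      continuous_map (tree_topology carrier tree_rel) (Metric_space.mtopology B d) \<psi> \<and>
      (\<forall>b\<in>B. discrete_subset (tree_topology carrier tree_rel) {x\<in>carrier. \<psi> x = b}))"
  proof
    assume "\<exists>\<psi> :: nat set \<Rightarrow> 'b.
      continuous_map (tree_topology carrier tree_rel) (Metric_space.mtopology B d) \<psi> \<and>
      (\<forall>b\<in>B. discrete_subset (tree_topology carrier tree_rel) {x\<in>carrier. \<psi> x = b})"
    then obtain \<psi> where
      cont: "continuous_map (tree_topology carrier tree_rel) (Metric_space.mtopology B d) \<psi>" and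
      disc: "\<And>b. b \<in> B \<Longrightarrow> discrete_subset (tree_topology carrier tree_rel) {x\<in>carrier. \<psi> x = b}"
      by blast
    define \<phi> where "\<phi> x = \<psi> (j x)" for x
    have \<phi>_in: "\<phi> x \<in> B" for x
    proof -
      have "\<psi> ` carrier \<subseteq> B"
        using continuous_map_image_subset_topspace[OF cont]
        by (simp add: topspace_tree_topology[OF is_tree_carrier] Metric_space.topspace_mtopology[OF assms(2)])
      then show ?thesis unfolding \<phi>_def carrier_def by blast
    qed
    have \<phi>_cont: "\<exists>\<beta><lev y. \<forall>x\<in>f y. \<beta> < lev x \<longrightarrow> d (\<phi> x) (\<phi> y) < \<epsilon>"
      if "limit (lev y)" "\<epsilon> > 0" for y \<epsilon>
      unfolding \<phi>_def using continuous_at_limit[OF assms(2) cont that] .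
    have good: "good_level B d f \<phi> \<alpha>" if lim: "limit \<alpha>" and eq: "\<And>x. lev x < \<alpha> \<Longrightarrow> g \<alpha> x = \<phi> x" for \<alpha>
    proof -
      have conv_iff: "converges B d (g \<alpha>) \<alpha> P \<longleftrightarrow> converges B d \<phi> \<alpha> P"
        if "lev y = \<alpha>" "admissible f y P" for y P
      proof (rule converges_cong)
        show "branch f \<alpha> P" using that by (simp add: admissible_def)
      qed (rule eq)
      have conv: "converges B d \<phi> \<alpha> P" if y: "lev y = \<alpha>" "admissible f y P" for y P
      proof (rule ccontr)
        assume neg: "\<not> ?thesis"
        have "\<not> converges B d (g \<alpha>) \<alpha> P"
          using neg conv_iff[OF y] by blast
        then have "W f y (f y)" using W[OF y(2)] y(1) unfolding W_def by blast
        moreover have "converges B d \<phi> \<alpha> (f y)"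
          unfolding converges_def using \<phi>_cont[of y] \<phi>_in lim y(1) by blast
        then have "converges B d (g \<alpha>) \<alpha> (f y)"
          using conv_iff[OF y(1) adm] by blast
        ultimately show False
          using \<open>\<not> converges B d (g \<alpha>) \<alpha> P\<close> y unfolding W_def by blast
      qed
      have conv': "converges B d (g \<alpha>) \<alpha> P" if y: "lev y = \<alpha>" "admissible f y P" for y P
        using conv[OF y] conv_iff[OF y] by blast
      have "generic d f \<phi> y (f y)" if y: "lev y = \<alpha>" "admissible f y P" "generic d f \<phi> y P" for y P
      proof -
        have iff: "generic d f (g \<alpha>) y Q \<longleftrightarrow> generic d f \<phi> y Q" for Q
          using generic_cong[of y "g \<alpha>" \<phi> f f] eq y(1) by blast
        have "W f y P" using conv' y iff unfolding W_def by blast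
        then have "W f y (f y)" using W y(2) by blast
        then show ?thesis using conv'[OF y(1) adm] y(1) iff unfolding W_def by blast
      qed
      then show ?thesis unfolding good_level_def using lim conv by blast
    qed
    interpret Metric_space B d by fact
    interpret guessed_map B d f \<phi>
    proof unfold_locales
      show "\<phi> x \<in> B" for x by (rule \<phi>_in)
      show "\<exists>\<beta><lev y. \<forall>x\<in>f y. \<beta> < lev x \<longrightarrow> d (\<phi> x) (\<phi> y) < \<epsilon>" if "limit (lev y)" "0 < \<epsilon>" for y \<epsilon>
        using \<phi>_cont that .
      show "\<exists>\<beta><lev y. \<forall>x\<in>f y. \<beta> < lev x \<longrightarrow> \<phi> x \<noteq> \<phi> y" if "limit (lev y)" for y
        using discrete_fibre_at_limit[OF _ that] disc[OF \<phi>_in[of y]] unfolding \<phi>_def by blast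
      fix F :: "node \<Rightarrow> node set" assume "\<And>x. countable (F x)"
      then obtain \<alpha> where "limit \<alpha>" "\<forall>x. lev x < \<alpha> \<longrightarrow> (\<forall>y\<in>F x. lev y < \<alpha>)" "\<forall>x. lev x < \<alpha> \<longrightarrow> g \<alpha> x = \<phi> x"
        using g[of \<phi> F] \<phi>_in by blast
      then show "\<exists>\<alpha>. good_level B d f \<phi> \<alpha> \<and> (\<forall>x. lev x < \<alpha> \<longrightarrow> (\<forall>y\<in>F x. lev y < \<alpha>))"
        using good by blast
    qed
    show False using cantor_subset_exists assms(3) by blast
  qed
  then show ?thesis using special_aronszajn by blast
qed

end
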